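(* Let $Q=(q_1,\dots,q_n)$ with $q_i\in\mathbb C\setminus\{0,1\}$ and $\Lambda=(\lambda_{ij})$ an $n\times n$ matrix over $\mathbb C\setminus\{0\}$ with $\lambda_{ii}=1$, $\lambda_{ij}=\lambda_{ji}^{-1}$, and assume the group $G(Q,\Lambda)\subseteq\mathbb C^\times$ generated by all $q_i,\lambda_{ij}$ is torsion free; let $\eta_1,\dots,\eta_r$ be a basis, $\{\mu_1,\dots,\mu_r\}\subset\mathbb C$ $\mathbb Q$-linearly independent, and $d:G(Q,\Lambda)\to\mathbb C$, $d(\eta_1^{s_1}\cdots\eta_r^{s_r})=\sum_is_i\mu_i$. Let $A_1$ be the Poisson algebra $\mathbb C[y_1,x_1,\dots,y_n,x_n]$ with bracket, for $1\le i<j\le n$: $\{y_j,y_i\}=d(\lambda_{ji})y_iy_j$, $\{y_j,x_i\}=d(\lambda_{ij})x_iy_j$, $\{x_j,y_i\}=(d(q_i)+d(\lambda_{ij}))y_ix_j$, $\{x_j,x_i\}=-(d(q_i)+d(\lambda_{ij}))x_ix_j$, and for $1\le i\le n$: $\{x_i,y_i\}=d(q_i)(1+\sum_{k=1}^iy_kx_k)$. Then $A_1$ satisfies the Poisson Dixmier–Moeglin equivalence: for a Poisson prime ideal $P$ of $A_1$, the following are equivalent: (i) $P$ is Poisson primitive; (ii) $P$ is rational; (iii) $P$ is locally closed.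
   Context: For a Poisson algebra $B$: a Poisson ideal is an ideal $I$ with $\{I,B\}\subseteq I$; a Poisson ideal $P$ is Poisson prime if for Poisson ideals $I,J$, $IJ\subseteq P$ implies $I\subseteq P$ or $J\subseteq P$. The Poisson core of an ideal $I$ is the largest Poisson ideal contained in $I$; $P$ is Poisson primitive if it is the Poisson core of some maximal ideal. $P$ is rational if the Poisson center (elements $f$ with $\{f,-\}=0$) of the quotient field of $B/P$ equals $\mathbb C$. $P$ is locally closed if the intersection of all Poisson prime ideals properly containing $P$ strictly contains $P$. ($A_1$ is the multi-parameter Poisson Weyl algebra, the semiclassical limit of a deformation of the quantized Weyl algebra.) *)

theory Defs
  imports Complex_Main "HOL-Library.Poly_Mapping"
begin

type_synonym 'v cpoly = "('v \<Rightarrow>\<^sub>0 nat) \<Rightarrow>\<^sub>0 complex"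

definition pvar :: "'v \<Rightarrow> 'v cpoly" where
  "pvar v = Poly_Mapping.single (Poly_Mapping.single v 1) 1"

definition pconst :: "complex \<Rightarrow> 'v cpoly" where
  "pconst c = Poly_Mapping.single 0 c"

definition pderiv_var :: "'v \<Rightarrow> 'v cpoly \<Rightarrow> 'v cpoly" where
  "pderiv_var v p = (\<Sum>m::'v \<Rightarrow>\<^sub>0 nat \<in> Poly_Mapping.keys p.
      Poly_Mapping.single (m - Poly_Mapping.single v (1::nat))
        (Poly_Mapping.lookup p m * of_nat (Poly_Mapping.lookup m v)))"

definition bracket_from_gens :: "('v::finite \<Rightarrow> 'v \<Rightarrow> 'v cpoly) \<Rightarrow> 'v cpoly \<Rightarrow> 'v cpoly \<Rightarrow> 'v cpoly" where
  "bracket_from_gens gb f g = (\<Sum>a\<in>UNIV. \<Sum>b\<in>UNIV. pderiv_var a f * pderiv_var b g * gb a b)"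

definition is_ideal :: "'a::comm_ring_1 set \<Rightarrow> bool" where
  "is_ideal I \<longleftrightarrow> 0 \<in> I \<and> (\<forall>a\<in>I. \<forall>b\<in>I. a + b \<in> I) \<and> (\<forall>r. \<forall>a\<in>I. r * a \<in> I)"

definition maximal_ideal :: "'a::comm_ring_1 set \<Rightarrow> bool" where
  "maximal_ideal M \<longleftrightarrow> is_ideal M \<and> M \<noteq> UNIV \<and>
     (\<forall>J. is_ideal J \<and> M \<subseteq> J \<longrightarrow> J = M \<or> J = UNIV)"

definition ideal_prod :: "'a::comm_ring_1 set \<Rightarrow> 'a set \<Rightarrow> 'a set" where
  "ideal_prod I J = \<Inter>{K. is_ideal K \<and> {a * b | a b. a \<in> I \<and> b \<in> J} \<subseteq> K}"

definition poisson_ideal :: "('a::comm_ring_1 \<Rightarrow> 'a \<Rightarrow> 'a) \<Rightarrow> 'a set \<Rightarrow> bool" where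
  "poisson_ideal pb I \<longleftrightarrow> is_ideal I \<and> (\<forall>a\<in>I. \<forall>b. pb a b \<in> I)"

definition poisson_prime :: "('a::comm_ring_1 \<Rightarrow> 'a \<Rightarrow> 'a) \<Rightarrow> 'a set \<Rightarrow> bool" where
  "poisson_prime pb P \<longleftrightarrow> poisson_ideal pb P \<and> P \<noteq> UNIV \<and>
     (\<forall>I J. poisson_ideal pb I \<and> poisson_ideal pb J \<and> ideal_prod I J \<subseteq> P
        \<longrightarrow> I \<subseteq> P \<or> J \<subseteq> P)"

definition is_poisson_core :: "('a::comm_ring_1 \<Rightarrow> 'a \<Rightarrow> 'a) \<Rightarrow> 'a set \<Rightarrow> 'a set \<Rightarrow> bool" where
  "is_poisson_core pb I P \<longleftrightarrow> poisson_ideal pb P \<and> P \<subseteq> I \<and>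
     (\<forall>J. poisson_ideal pb J \<and> J \<subseteq> I \<longrightarrow> J \<subseteq> P)"

definition poisson_primitive :: "('a::comm_ring_1 \<Rightarrow> 'a \<Rightarrow> 'a) \<Rightarrow> 'a set \<Rightarrow> bool" where
  "poisson_primitive pb P \<longleftrightarrow> (\<exists>M. maximal_ideal M \<and> is_poisson_core pb M P)"

text \<open>Rationality, written out in terms of B: an element a/b (b not in P) of the
  quotient field of B/P is Poisson central iff {a,c} b - a {b,c} lies in P for all c
  (quotient rule), and it is a scalar iff a - k b lies in P for some complex k.
  The scalars are embedded via emb.\<close>
definition poisson_rational ::
  "('a::comm_ring_1 \<Rightarrow> 'a \<Rightarrow> 'a) \<Rightarrow> (complex \<Rightarrow> 'a) \<Rightarrow> 'a set \<Rightarrow> bool" where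
  "poisson_rational pb emb P \<longleftrightarrow>
     (\<forall>a b. b \<notin> P \<and> (\<forall>c. pb a c * b - a * pb b c \<in> P)
        \<longrightarrow> (\<exists>k. a - emb k * b \<in> P))"

definition poisson_locally_closed :: "('a::comm_ring_1 \<Rightarrow> 'a \<Rightarrow> 'a) \<Rightarrow> 'a set \<Rightarrow> bool" where
  "poisson_locally_closed pb P \<longleftrightarrow> \<Inter>{Q. poisson_prime pb Q \<and> P \<subset> Q} \<noteq> P"

definition gen_group :: "complex set \<Rightarrow> complex set" where
  "gen_group S = {(\<Prod>s\<in>F. s powi k s) | F k. finite F \<and> F \<subseteq> S}"

definition Yv :: "'n \<Rightarrow> ('n \<times> bool) cpoly" where "Yv i = pvar (i, False)"
definition Xv :: "'n \<Rightarrow> ('n \<times> bool) cpoly" where "Xv i = pvar (i, True)"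

text \<open>Bracket of generators {a,b}; pairs with first index > second index and the
  pairs (x_i,y_i) are given, the rest determined by antisymmetry.\<close>
definition A1_gen_bracket ::
  "(complex \<Rightarrow> complex) \<Rightarrow> ('n::{finite,linorder} \<Rightarrow> complex) \<Rightarrow> ('n \<Rightarrow> 'n \<Rightarrow> complex)
   \<Rightarrow> 'n \<times> bool \<Rightarrow> 'n \<times> bool \<Rightarrow> ('n \<times> bool) cpoly" where
  "A1_gen_bracket d Q L a b =
    (let later = (\<lambda>(j::'n, s::bool) (i::'n, t::bool).
        (if \<not> s \<and> \<not> t then pconst (d (L j i)) * Yv i * Yv j
         else if \<not> s \<and> t then pconst (d (L i j)) * Xv i * Yv j
         else if s \<and> \<not> t then pconst (d (Q i) + d (L i j)) * Yv i * Xv j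
         else - (pconst (d (Q i) + d (L i j)) * Xv i * Xv j)));
         diag = (\<lambda>i::'n. pconst (d (Q i)) * (1 + (\<Sum>k\<in>{..i}. Yv k * Xv k)))
     in if fst a = fst b then
          (if snd a = snd b then 0
           else if snd a then diag (fst a) else - diag (fst a))
        else if fst b < fst a then later a b
        else - later b a)"

definition A1_bracket ::
  "(complex \<Rightarrow> complex) \<Rightarrow> ('n::{finite,linorder} \<Rightarrow> complex) \<Rightarrow> ('n \<Rightarrow> 'n \<Rightarrow> complex)
   \<Rightarrow> ('n \<times> bool) cpoly \<Rightarrow> ('n \<times> bool) cpoly \<Rightarrow> ('n \<times> bool) cpoly" where
  "A1_bracket d Q L = bracket_from_gens (A1_gen_bracket d Q L)"

end

(* A Poisson prime P is prime because the polynomial ring is Noetherian of characteristic 0.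

   Primitive implies rational and locally closed implies primitive are general: they use only that
   residue fields are the scalars (by uncountability of the complex numbers) and that maximal ideals
   can be chosen to avoid any given element outside P.

   For rational implies locally closed, put theta_i = 1 + sum_{k <= i} y_k x_k. Then
   y_i x_i = theta_i - theta_(i-1), and every theta_i is Poisson normal with scalar weights on the
   variables. Let Z consist of the y_i and theta_i outside P, and of the x_i outside P for which y_i
   is in P. Elements of Z have log-canonical brackets {z,w} = c z w, and after inverting them A/P is
   spanned by Laurent monomials in Z. Two monomials of equal weight have a Poisson central quotient
   modulo P, hence a scalar one; so a Poisson prime properly containing P contains a monomial in Z,
   that is, it contains the product of Z. *)

theory Submission
  imports Defs "HOL-Library.Product_Lexorder" "HOL-Analysis.Continuum_Not_Denumerable"
    "HOL-Computational_Algebra.Fundamental_Theorem_Algebra"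
begin

text \<open>Neither \<open>A/P\<close> nor its field of fractions is formed. Identities there are
  written as congruences modulo \<open>P\<close> with the denominators multiplied out, and since
  \<open>P\<close> is prime, a factor outside \<open>P\<close> may be cancelled again. The obstacle
  to log-canonical coordinates is the pair x_i, y_i, whose bracket is a multiple of theta_i and not
  of y_i x_i. Where y_i is invertible modulo \<open>P\<close>, theta_i replaces x_i, which is
  recovered by dividing by y_i. Where y_i lies in \<open>P\<close>, x_i itself may be kept. Both
  implications that involve maximal ideals need points: a maximal ideal at which functions are
  evaluated, and a maximal ideal that misses a prescribed element e. Ideals maximal among those
  avoiding the powers of e serve both purposes, so that one form of the Nullstellensatz
  suffices.\<close>

section \<open>Ideals\<close>

lemma is_idealD:
  assumes "is_ideal I"
  shows "0 \<in> I"
    and "a \<in> I \<Longrightarrow> b \<in> I \<Longrightarrow> a + b \<in> I"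
    and "a \<in> I \<Longrightarrow> r * a \<in> I"
    and "a \<in> I \<Longrightarrow> a * r \<in> I"
  using assms by (simp_all add: is_ideal_def mult.commute[of a r])

lemma is_ideal_uminus:
  assumes "is_ideal I" "a \<in> I" shows "- a \<in> I"
  using is_idealD(3)[OF assms, of "- 1"] by simp

lemma is_ideal_diff:
  assumes "is_ideal I" "a \<in> I" "b \<in> I" shows "a - b \<in> I"
  using is_idealD(2)[OF assms(1,2) is_ideal_uminus[OF assms(1,3)]] by simp

lemma is_ideal_sum:
  assumes "is_ideal I" "\<And>x. x \<in> S \<Longrightarrow> f x \<in> I" shows "sum f S \<in> I"
  using assms(2) by (induction S rule: infinite_finite_induct) (auto intro: is_idealD[OF assms(1)])

lemma is_ideal_add_cancel:
  assumes "is_ideal I" "a - b \<in> I" shows "a \<in> I \<longleftrightarrow> b \<in> I"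
  using is_idealD(2)[OF assms(1), of "a - b" b] is_ideal_diff[OF assms(1), of a "a - b"] assms(2)
  by auto

lemma is_ideal_eq_UNIV: "is_ideal I \<Longrightarrow> 1 \<in> I \<Longrightarrow> I = UNIV"
  using is_idealD(3)[of I 1] by auto

lemma ideal_prod_subset_iff:
  "is_ideal K \<Longrightarrow> ideal_prod I J \<subseteq> K \<longleftrightarrow> (\<forall>a\<in>I. \<forall>b\<in>J. a * b \<in> K)"
  unfolding ideal_prod_def by blast

lemma is_ideal_sum_principal:
  assumes "is_ideal I" shows "is_ideal {i + r * x | i r. i \<in> I}"
  unfolding is_ideal_def
proof (intro conjI ballI allI)
  show "0 \<in> {i + r * x | i r. i \<in> I}"
    using is_idealD(1)[OF assms] by (force intro: exI[of _ 0])
next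
  fix a b assume "a \<in> {i + r * x | i r. i \<in> I}" "b \<in> {i + r * x | i r. i \<in> I}"
  then obtain i r j s where "a = i + r * x" "b = j + s * x" "i \<in> I" "j \<in> I" by auto
  then have "a + b = (i + j) + (r + s) * x" "i + j \<in> I"
    using is_idealD[OF assms] by (auto simp: algebra_simps)
  then show "a + b \<in> {i + r * x | i r. i \<in> I}" by blast
next
  fix t a assume "a \<in> {i + r * x | i r. i \<in> I}"
  then obtain i r where "a = i + r * x" "i \<in> I" by auto
  then have "t * a = t * i + (t * r) * x" "t * i \<in> I"
    using is_idealD[OF assms] by (auto simp: algebra_simps)
  then show "t * a \<in> {i + r * x | i r. i \<in> I}" by blast
qed

section \<open>Prime ideals, and ideals avoiding the powers of an element\<close>

definition prime_ideal :: "'a::comm_ring_1 set \<Rightarrow> bool" where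
  "prime_ideal P \<longleftrightarrow> is_ideal P \<and> 1 \<notin> P \<and> (\<forall>a b. a * b \<in> P \<longrightarrow> a \<in> P \<or> b \<in> P)"

lemma prime_idealD:
  assumes "prime_ideal P"
  shows "is_ideal P" "1 \<notin> P" "a * b \<in> P \<Longrightarrow> a \<in> P \<or> b \<in> P"
  using assms by (auto simp: prime_ideal_def)

lemma prime_ideal_power: "prime_ideal P \<Longrightarrow> a ^ k \<in> P \<Longrightarrow> a \<in> P"
  by (induction k) (auto simp: prime_ideal_def)

lemma prime_ideal_prod:
  assumes "prime_ideal P" "finite S" "(\<Prod>x\<in>S. f x) \<in> P" shows "\<exists>x\<in>S. f x \<in> P"
  using assms(2,3) by (induction S rule: finite_induct) (use assms(1) in \<open>auto simp: prime_ideal_def\<close>)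

text \<open>These are the contractions of the maximal ideals of the localization at
  \<open>e\<close>, described without the localization. For \<open>e = 1\<close> they are the
  maximal ideals.\<close>

definition maximal_avoiding :: "'a::comm_ring_1 \<Rightarrow> 'a set \<Rightarrow> bool" where
  "maximal_avoiding e I \<longleftrightarrow> is_ideal I \<and> (\<forall>k. e ^ k \<notin> I) \<and>
     (\<forall>J. is_ideal J \<and> I \<subset> J \<longrightarrow> (\<exists>k. e ^ k \<in> J))"

text \<open>Maximality is applied to the ideal generated by \<open>I\<close> and \<open>x\<close>:
  modulo \<open>I\<close>, every \<open>x\<close> outside \<open>I\<close> divides a power of
  \<open>e\<close>.\<close>

lemma maximal_avoiding_elem:
  assumes "maximal_avoiding e I" "x \<notin> I"
  obtains k r where "e ^ k - r * x \<in> I"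
proof -
  have I: "is_ideal I" using assms by (simp add: maximal_avoiding_def)
  let ?J = "{i + r * x | i r. i \<in> I}"
  have "I \<subseteq> ?J" by (force intro: exI[of _ 0])
  moreover have "x \<in> ?J" using is_idealD(1)[OF I] by (force intro: exI[of _ 0] exI[of _ 1])
  ultimately have "I \<subset> ?J" using assms(2) by auto
  then obtain k where "e ^ k \<in> ?J"
    using assms(1) is_ideal_sum_principal[OF I, of x] unfolding maximal_avoiding_def by blast
  then obtain i r where "e ^ k = i + r * x" "i \<in> I" by auto
  then show thesis by (intro that[of k r]) auto
qed

lemma maximal_avoiding_prime:
  assumes "maximal_avoiding e I" shows "prime_ideal I"
proof -
  have I: "is_ideal I" and e: "\<And>k. e ^ k \<notin> I"
    using assms by (simp_all add: maximal_avoiding_def)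
  have "a \<in> I \<or> b \<in> I" if ab: "a * b \<in> I" for a b
  proof (rule ccontr)
    assume "\<not> (a \<in> I \<or> b \<in> I)"
    then obtain k r l s where *: "e ^ k - r * a \<in> I" "e ^ l - s * b \<in> I"
      using maximal_avoiding_elem[OF assms] by metis
    have "e ^ (k + l) = e ^ l * (e ^ k - r * a) + r * a * (e ^ l - s * b) + r * s * (a * b)"
      by (simp add: power_add algebra_simps)
    also have "\<dots> \<in> I" using * ab is_idealD(2,3)[OF I] by presburger
    finally show False using e by blast
  qed
  then show ?thesis using I e[of 0] by (auto simp: prime_ideal_def)
qed

lemma maximal_avoiding_exists:
  assumes "is_ideal P" "\<And>k. e ^ k \<notin> P"
  obtains I where "P \<subseteq> I" "maximal_avoiding e I"
proof -
  let ?A = "{I. is_ideal I \<and> P \<subseteq> I \<and> (\<forall>k. e ^ k \<notin> I)}"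
  have "\<exists>U\<in>?A. \<forall>X\<in>C. X \<subseteq> U" if C: "subset.chain ?A C" for C
  proof (cases "C = {}")
    \<comment> \<open>The union of the empty chain is no ideal; here \<open>P\<close> itself is the
      upper bound.\<close>
    case True then show ?thesis using assms by auto
  next
    case False
    have mem: "is_ideal X" "P \<subseteq> X" "e ^ k \<notin> X" if "X \<in> C" for X k
      using C that by (auto simp: subset_chain_def)
    have "is_ideal (\<Union>C)" unfolding is_ideal_def
    proof (intro conjI ballI allI)
      show "0 \<in> \<Union>C" using False mem(1) is_idealD(1) by blast
      fix a b assume "a \<in> \<Union>C" "b \<in> \<Union>C"
      then obtain X Y where "X \<in> C" "Y \<in> C" "a \<in> X" "b \<in> Y" by auto
      moreover from this have "X \<subseteq> Y \<or> Y \<subseteq> X" using C by (auto simp: subset_chain_def)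
      ultimately show "a + b \<in> \<Union>C" using mem(1) is_idealD(2) by (metis UnionI subsetD)
    next
      fix r a assume "a \<in> \<Union>C"
      then show "r * a \<in> \<Union>C" using mem(1) is_idealD(3) by blast
    qed
    moreover have "P \<subseteq> \<Union>C" "e ^ k \<notin> \<Union>C" for k using False mem by blast+
    ultimately show ?thesis by (intro bexI[of _ "\<Union>C"]) auto
  qed
  then obtain I where I: "I \<in> ?A" "\<forall>X\<in>?A. I \<subseteq> X \<longrightarrow> X = I"
    using subset_Zorn[of ?A] by blast
  then have "maximal_avoiding e I" unfolding maximal_avoiding_def by blast
  then show thesis using I(1) that by blast
qed

lemma maximal_ideal_avoiding_one:
  assumes "maximal_ideal M" shows "maximal_avoiding 1 M"
  using assms is_ideal_eq_UNIV[of M] unfolding maximal_ideal_def maximal_avoiding_def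
  by auto

lemma maximal_idealI:
  assumes "is_ideal M" "1 \<notin> M" "\<And>x. x \<notin> M \<Longrightarrow> \<exists>y. 1 - y * x \<in> M"
  shows "maximal_ideal M"
  unfolding maximal_ideal_def
proof (intro conjI allI impI)
  fix J assume J: "is_ideal J \<and> M \<subseteq> J"
  show "J = M \<or> J = UNIV"
  proof (rule disjCI)
    assume "J \<noteq> UNIV"
    show "J = M"
    proof (rule ccontr)
      assume "J \<noteq> M"
      then obtain x where "x \<in> J" "x \<notin> M" using J by auto
      then obtain y where "1 - y * x \<in> J" using assms(3) J by blast
      then have "1 \<in> J"
        using is_ideal_add_cancel[of J 1 "y * x"] J is_idealD(3)[of J x y] \<open>x \<in> J\<close> by auto
      then show False using is_ideal_eq_UNIV \<open>J \<noteq> UNIV\<close> J by blast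
    qed
  qed
qed (use assms in auto)

section \<open>Poisson ideals\<close>

locale pre_poisson =
  fixes pb :: "'a::comm_ring_1 \<Rightarrow> 'a \<Rightarrow> 'a"
  assumes pb_add_left: "pb (a + b) c = pb a c + pb b c"
    and pb_mult_left: "pb (a * b) c = a * pb b c + pb a c * b"
    and pb_antisym: "pb a b = - pb b a"
begin

lemma pb_zero_left: "pb 0 c = 0"
  using pb_add_left[of 0 0 c] by simp

lemma pb_uminus_left: "pb (- a) c = - pb a c"
  using pb_add_left[of a "- a" c] by (simp add: pb_zero_left eq_neg_iff_add_eq_0 add.commute)

lemma pb_diff_left: "pb (a - b) c = pb a c - pb b c"
  using pb_add_left[of a "- b" c] by (simp add: pb_uminus_left)

lemma pb_one_left: "pb 1 c = 0"
  using pb_mult_left[of 1 1 c] by simp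

lemma pb_add_right: "pb c (a + b) = pb c a + pb c b"
  using pb_add_left[of a b c] pb_antisym[of c] by (simp add: algebra_simps)

lemma pb_mult_right: "pb c (a * b) = a * pb c b + pb c a * b"
  using pb_mult_left[of a b c] pb_antisym[of c] by (simp add: algebra_simps)

lemma pb_diff_right: "pb c (a - b) = pb c a - pb c b"
  using pb_diff_left[of a b c] pb_antisym[of c] by simp

lemma pb_zero_right: "pb c 0 = 0"
  using pb_zero_left[of c] pb_antisym[of c] by simp

lemma pb_sum_left: "pb (\<Sum>x\<in>S. f x) c = (\<Sum>x\<in>S. pb (f x) c)"
  by (induction S rule: infinite_finite_induct) (simp_all add: pb_add_left pb_zero_left)

lemma pb_sum_right: "pb c (\<Sum>x\<in>S. f x) = (\<Sum>x\<in>S. pb c (f x))"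
  by (induction S rule: infinite_finite_induct) (simp_all add: pb_add_right pb_zero_right)

lemma pb_power_left: "pb (a ^ Suc n) c = of_nat (Suc n) * a ^ n * pb a c"
  by (induction n) (simp_all add: pb_mult_left algebra_simps)

lemma poisson_idealI:
  assumes "0 \<in> I" "\<And>a b. a \<in> I \<Longrightarrow> b \<in> I \<Longrightarrow> a + b \<in> I"
    and "\<And>r a. a \<in> I \<Longrightarrow> r * a \<in> I" "\<And>a b. a \<in> I \<Longrightarrow> pb a b \<in> I"
  shows "poisson_ideal pb I"
  using assms by (auto simp: poisson_ideal_def is_ideal_def)

lemma poisson_idealD:
  assumes "poisson_ideal pb I"
  shows "is_ideal I" "a \<in> I \<Longrightarrow> pb a b \<in> I" "a \<in> I \<Longrightarrow> pb b a \<in> I"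
  using assms is_ideal_uminus[of I "pb a b"] pb_antisym[of b a] by (auto simp: poisson_ideal_def)

text \<open>The sum of all Poisson ideals inside \<open>M\<close> is already their union, because two of them have
  their sum inside \<open>M\<close>.\<close>

lemma poisson_core_exists:
  assumes M: "is_ideal M"
  obtains C where "is_poisson_core pb M C"
proof -
  let ?C = "\<Union>{J. poisson_ideal pb J \<and> J \<subseteq> M}"
  have z: "poisson_ideal pb {0}"
    by (simp add: poisson_ideal_def is_ideal_def pb_zero_left)
  have "poisson_ideal pb ?C"
  proof (rule poisson_idealI)
    show "0 \<in> ?C" using z is_idealD(1)[OF M] by blast
    fix a b assume "a \<in> ?C" "b \<in> ?C"
    then obtain I J where IJ: "poisson_ideal pb I" "poisson_ideal pb J" "I \<subseteq> M" "J \<subseteq> M" "a \<in> I" "b \<in> J"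
      by auto
    let ?K = "{i + j | i j. i \<in> I \<and> j \<in> J}"
    have "poisson_ideal pb ?K"
    proof (rule poisson_idealI)
      show "0 \<in> ?K" using is_idealD(1)[OF poisson_idealD(1)] IJ(1,2) by force
      fix x y assume "x \<in> ?K" "y \<in> ?K"
      then obtain i j i' j' where "x = i + j" "y = i' + j'" "i \<in> I" "i' \<in> I" "j \<in> J" "j' \<in> J" by auto
      then have "x + y = (i + i') + (j + j')" "i + i' \<in> I" "j + j' \<in> J"
        using is_idealD(2)[OF poisson_idealD(1)] IJ(1,2) by (auto simp: algebra_simps)
      then show "x + y \<in> ?K" by blast
    next
      fix r x assume "x \<in> ?K"
      then obtain i j where x: "x = i + j" "i \<in> I" "j \<in> J" by auto
      then have "r * x = r * i + r * j" "r * i \<in> I" "r * j \<in> J"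
        using is_idealD(3)[OF poisson_idealD(1)] IJ(1,2) by (auto simp: algebra_simps)
      then show "r * x \<in> ?K" by blast
    next
      fix x r assume "x \<in> ?K"
      then obtain i j where x: "x = i + j" "i \<in> I" "j \<in> J" by auto
      then have "pb x r = pb i r + pb j r" "pb i r \<in> I" "pb j r \<in> J"
        using poisson_idealD(2) IJ(1,2) by (auto simp: pb_add_left)
      then show "pb x r \<in> ?K" by blast
    qed
    moreover have "?K \<subseteq> M" using IJ is_idealD(2)[OF M] by auto
    ultimately show "a + b \<in> ?C" using IJ by blast
  next
    fix r a assume "a \<in> ?C"
    then show "r * a \<in> ?C" using poisson_idealD(1) is_idealD(3) by blast
  next
    fix a b assume "a \<in> ?C"
    then show "pb a b \<in> ?C" using poisson_idealD(2) by blast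
  qed
  then have "is_poisson_core pb M ?C" unfolding is_poisson_core_def by blast
  then show thesis by (rule that)
qed

text \<open>If a product of Poisson ideals lies in the core, then one factor lies in the prime
  \<open>M\<close>, and the core absorbs every Poisson ideal inside \<open>M\<close>.\<close>

lemma poisson_prime_core:
  assumes M: "prime_ideal M" and C: "is_poisson_core pb M C"
  shows "poisson_prime pb C"
  unfolding poisson_prime_def
proof (intro conjI allI impI)
  show "poisson_ideal pb C" "C \<noteq> UNIV"
    using C prime_idealD(2)[OF M] by (auto simp: is_poisson_core_def)
  fix I J assume *: "poisson_ideal pb I \<and> poisson_ideal pb J \<and> ideal_prod I J \<subseteq> C"
  then have "ideal_prod I J \<subseteq> M" using C by (auto simp: is_poisson_core_def)
  then have "I \<subseteq> M \<or> J \<subseteq> M"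
    using ideal_prod_subset_iff[OF prime_idealD(1)[OF M], of I J] prime_idealD(3)[OF M] by blast
  then show "I \<subseteq> C \<or> J \<subseteq> C" using C * by (auto simp: is_poisson_core_def)
qed

text \<open>By the Leibniz rule the elements that multiply \<open>X\<close> into \<open>P\<close>
  form a Poisson ideal. This turns Poisson primeness, a condition on ideals, into one about single
  elements.\<close>

lemma poisson_prime_transporter:
  assumes P: "poisson_prime pb P" and X: "poisson_ideal pb X" "\<not> X \<subseteq> P"
    and u: "\<forall>x\<in>X. u * x \<in> P"
  shows "u \<in> P"
proof -
  let ?T = "{u. \<forall>x\<in>X. u * x \<in> P}"
  have Pi: "poisson_ideal pb P" and I: "is_ideal P"
    using P poisson_idealD(1) by (auto simp: poisson_prime_def)
  have "poisson_ideal pb ?T"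
  proof (rule poisson_idealI)
    fix a b assume a: "a \<in> ?T"
    have "pb a b * x \<in> P" if "x \<in> X" for x
    proof -
      have "pb a b * x = pb (a * x) b - a * pb x b" by (simp add: pb_mult_left algebra_simps)
      moreover have "pb x b \<in> X" using poisson_idealD(2)[OF X(1) that] .
      ultimately show ?thesis
        using a that poisson_idealD(2)[OF Pi] is_ideal_diff[OF I] by auto
    qed
    then show "pb a b \<in> ?T" by blast
  next
    fix r a assume "a \<in> ?T"
    then show "r * a \<in> ?T" using is_idealD(3)[OF I] by (auto simp: mult.assoc)
  qed (auto simp: distrib_right intro: is_idealD(1,2)[OF I])
  moreover have "ideal_prod ?T X \<subseteq> P" using ideal_prod_subset_iff[OF I] by blast
  ultimately have "?T \<subseteq> P" using P X unfolding poisson_prime_def by blast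
  then show ?thesis using u by blast
qed

end

text \<open>The last two axioms stand for Hilbert's basis theorem and the Nullstellensatz, so that
  the general theory never looks inside a polynomial.\<close>

locale affine_poisson = pre_poisson pb for pb :: "'a::comm_ring_1 \<Rightarrow> 'a \<Rightarrow> 'a" +
  fixes emb :: "complex \<Rightarrow> 'a"
  assumes emb_1: "emb 1 = 1"
    and emb_add: "emb (x + y) = emb x + emb y"
    and emb_mult: "emb (x * y) = emb x * emb y"
    and pb_emb: "pb (emb x) c = 0"
    and ideal_finitely_generated:
      "is_ideal I \<Longrightarrow> \<exists>G. finite G \<and> G \<subseteq> I \<and> (\<forall>J. is_ideal J \<longrightarrow> G \<subseteq> J \<longrightarrow> I \<subseteq> J)"
    and residue_scalar: "maximal_avoiding e I \<Longrightarrow> \<exists>c. f - emb c \<in> I"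
begin

section \<open>Scalars, and the primeness of Poisson primes\<close>

lemma emb_0: "emb 0 = 0"
  using emb_add[of 0 0] by simp

lemma emb_uminus: "emb (- x) = - emb x"
  using emb_add[of x "- x"] by (simp add: emb_0 eq_neg_iff_add_eq_0 add.commute)

lemma emb_diff: "emb (x - y) = emb x - emb y"
  using emb_add[of x "- y"] by (simp add: emb_uminus)

lemma emb_of_nat: "emb (of_nat n) = of_nat n"
  by (induction n) (simp_all add: emb_0 emb_1 emb_add)

lemma emb_cancel:
  assumes "is_ideal I" "emb x * a \<in> I" "x \<noteq> 0" shows "a \<in> I"
proof -
  have "emb (inverse x) * (emb x * a) = emb (inverse x * x) * a"
    by (simp add: emb_mult mult.assoc)
  then show ?thesis using is_idealD(3)[OF assms(1,2), of "emb (inverse x)"] assms(3)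
    by (simp add: emb_1)
qed

lemma of_nat_cancel:
  fixes I :: "'a set"
  assumes "is_ideal I" "of_nat n * a \<in> I" "n > 0" shows "a \<in> I"
  using emb_cancel[OF assms(1), of "of_nat n" a] assms(2,3) by (simp add: emb_of_nat)

text \<open>Each bracket with \<open>c\<close> trades one factor \<open>a\<close> for factors
  \<open>pb a c\<close>. The integer coefficients that arise are invertible, so the trade continues
  until no \<open>a\<close> is left.\<close>

lemma derivative_nilpotent:
  assumes P: "poisson_ideal pb P" and "a ^ n \<in> P"
  shows "\<exists>m. (pb a c) ^ m \<in> P"
proof -
  note I = poisson_idealD(1)[OF P]
  have "\<exists>m. a ^ (n - j) * (pb a c) ^ m \<in> P" if "j \<le> n" for j
    using that
  proof (induction j)
    case 0 then show ?case using assms(2) by (intro exI[of _ 0]) simp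
  next
    case (Suc j)
    then obtain m where m: "a ^ (n - j) * (pb a c) ^ m \<in> P" by auto
    define k where "k = n - Suc j"
    have k: "n - j = Suc k" using Suc.prems by (simp add: k_def)
    let ?b = "pb a c"
    have 1: "pb (a ^ Suc k * ?b ^ m) c = a ^ Suc k * pb (?b ^ m) c + of_nat (Suc k) * a ^ k * ?b * ?b ^ m"
      by (simp only: pb_mult_left pb_power_left)
    \<comment> \<open>The extra factor \<open>?b\<close> restores the power lost in differentiating
      \<open>?b ^ m\<close>, so this term is a multiple of the element already known to lie in
      \<open>P\<close>.\<close>
    have 2: "a ^ Suc k * pb (?b ^ m) c * ?b \<in> P"
    proof (cases m)
      case 0 then show ?thesis by (simp add: pb_one_left is_idealD(1)[OF I])
    next
      case (Suc i)
      have "a ^ Suc k * pb (?b ^ m) c * ?b = (of_nat m * pb ?b c) * (a ^ Suc k * ?b ^ m)"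
        unfolding Suc pb_power_left by (simp add: algebra_simps)
      then show ?thesis using m k is_idealD(3)[OF I] by simp
    qed
    have "pb (a ^ Suc k * ?b ^ m) c * ?b - a ^ Suc k * pb (?b ^ m) c * ?b \<in> P"
      using is_ideal_diff[OF I is_idealD(4)[OF I poisson_idealD(2)[OF P]] 2] m unfolding k .
    also have "pb (a ^ Suc k * ?b ^ m) c * ?b - a ^ Suc k * pb (?b ^ m) c * ?b
        = of_nat (Suc k) * (a ^ k * ?b ^ Suc (Suc m))"
      unfolding 1 by (simp add: algebra_simps)
    finally have "a ^ k * ?b ^ Suc (Suc m) \<in> P" by (rule of_nat_cancel[OF I]) simp
    then show ?case unfolding k_def by blast
  qed
  from this[of n] show ?thesis by simp
qed

text \<open>The radical of \<open>P\<close> is a Poisson ideal by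
  \<open>derivative_nilpotent\<close>. Being finitely generated, it is multiplied into
  \<open>P\<close> by one element \<open>u\<close> outside \<open>P\<close>, and the transporter
  lemma then forces it into \<open>P\<close>.\<close>

lemma poisson_prime_radical:
  assumes P: "poisson_prime pb P" and "a ^ n \<in> P" shows "a \<in> P"
proof -
  have Pi: "poisson_ideal pb P" "P \<noteq> UNIV" using P by (auto simp: poisson_prime_def)
  note I = poisson_idealD(1)[OF Pi(1)]
  have one: "1 \<notin> P" using is_ideal_eq_UNIV[OF I] Pi(2) by blast
  let ?N = "{x. \<exists>n. x ^ n \<in> P}"
  have N: "poisson_ideal pb ?N"
  proof (rule poisson_idealI)
    show "0 \<in> ?N" using is_idealD(1)[OF I] by (auto intro: exI[of _ 1])
    show "r * x \<in> ?N" if "x \<in> ?N" for r x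
      using that is_idealD(3)[OF I] by (auto simp: power_mult_distrib)
    show "pb x c \<in> ?N" if "x \<in> ?N" for x c
      using that derivative_nilpotent[OF Pi(1)] by blast
  next
    fix x y assume "x \<in> ?N" "y \<in> ?N"
    then obtain m n where mn: "x ^ m \<in> P" "y ^ n \<in> P" by auto
    have "x ^ i * y ^ (m + n - i) \<in> P" for i
    proof (cases "m \<le> i")
      case True
      then have "x ^ i = x ^ m * x ^ (i - m)" by (simp flip: power_add)
      then show ?thesis using mn(1) is_idealD(4)[OF I] by (simp add: mult.assoc)
    next
      case False
      then have "y ^ (m + n - i) = y ^ n * y ^ (m - i)" by (simp add: add.commute flip: power_add)
      then show ?thesis using mn(2) is_idealD(3,4)[OF I] by simp
    qed
    then have "(x + y) ^ (m + n) \<in> P" unfolding binomial_ring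
      by (intro is_ideal_sum[OF I]) (simp add: mult.assoc is_idealD(3)[OF I])
    then show "x + y \<in> ?N" by blast
  qed
  obtain G where G: "finite G" "G \<subseteq> ?N" "\<And>J. is_ideal J \<Longrightarrow> G \<subseteq> J \<Longrightarrow> ?N \<subseteq> J"
    using ideal_finitely_generated[OF poisson_idealD(1)[OF N]] by metis
  have "\<exists>u. u \<notin> P \<and> (\<forall>g\<in>G. u * g \<in> P)" using G(1,2)
  proof (induction G rule: finite_induct)
    case empty then show ?case using one by blast
  next
    case (insert g G)
    then obtain u where u: "u \<notin> P" "\<forall>g\<in>G. u * g \<in> P" by auto
    obtain n where "g ^ n \<in> P" using insert by auto
    then have ex: "\<exists>n. u * g ^ n \<in> P" using is_idealD(3)[OF I] by blast
    \<comment> \<open>The new multiplier is \<open>u\<close> times the highest power of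
      \<open>g\<close> for which the product stays outside \<open>P\<close>.\<close>
    define k where "k = (LEAST n. u * g ^ n \<in> P)"
    have k: "u * g ^ k \<in> P" unfolding k_def using ex by (rule LeastI_ex)
    then obtain j where j: "k = Suc j" using u(1) by (cases k) auto
    have "u * g ^ j \<notin> P" using not_less_Least[of j "\<lambda>n. u * g ^ n \<in> P"] j unfolding k_def by simp
    moreover have "u * g ^ j * h \<in> P" if "h \<in> insert g G" for h
    proof (cases "h = g")
      case True then show ?thesis using k j by (simp add: mult_ac)
    next
      case False
      then have "g ^ j * (u * h) \<in> P" using that u(2) is_idealD(3)[OF I] by blast
      then show ?thesis by (simp add: mult_ac)
    qed
    ultimately show ?case by blast
  qed
  then obtain u where u: "u \<notin> P" "\<forall>g\<in>G. u * g \<in> P" by blast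
  have "is_ideal {x. u * x \<in> P}"
    unfolding is_ideal_def using is_idealD[OF I] by (auto simp: distrib_left mult.left_commute)
  then have "?N \<subseteq> {x. u * x \<in> P}" using G(3) u(2) by blast
  then have "?N \<subseteq> P" using poisson_prime_transporter[OF P N] u(1) by blast
  then show ?thesis using assms(2) by blast
qed

text \<open>The annihilator of \<open>a\<close> modulo \<open>P\<close> is closed under brackets: if
  \<open>a * x\<close> is in \<open>P\<close>, then so is the square of \<open>a * pb x c\<close>,
  and \<open>P\<close> is radical. If it contains some \<open>b\<close> outside \<open>P\<close>,
  the transporter lemma gives \<open>a\<close> in \<open>P\<close>.\<close>

lemma poisson_prime_imp_prime:
  assumes P: "poisson_prime pb P" shows "prime_ideal P"
proof -
  have Pi: "poisson_ideal pb P" "P \<noteq> UNIV" using P by (auto simp: poisson_prime_def)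
  note I = poisson_idealD(1)[OF Pi(1)]
  have "a \<in> P \<or> b \<in> P" if ab: "a * b \<in> P" for a b
  proof (rule disjCI)
    assume b: "b \<notin> P"
    let ?T = "{x. a * x \<in> P}"
    have T: "poisson_ideal pb ?T"
    proof (rule poisson_idealI)
      fix x c assume x: "x \<in> ?T"
      have "(a * pb x c) * (a * pb x c) = pb (a * x) c * (a * pb x c) - (pb a c * pb x c) * (a * x)"
        by (simp add: pb_mult_left algebra_simps)
      also have "\<dots> \<in> P"
        by (rule is_ideal_diff[OF I is_idealD(4)[OF I poisson_idealD(2)[OF Pi(1)]] is_idealD(3)[OF I]])
          (use x in simp_all)
      finally show "pb x c \<in> ?T" using poisson_prime_radical[OF P, of "a * pb x c" 2]
        by (simp add: power2_eq_square)
    next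
      fix r x assume "x \<in> ?T"
      then have "r * (a * x) \<in> P" using is_idealD(3)[OF I] by blast
      then show "r * x \<in> ?T" by (simp add: mult.left_commute)
    qed (auto simp: is_idealD(1)[OF I] distrib_left intro: is_idealD(2)[OF I])
    show "a \<in> P"
      by (rule poisson_prime_transporter[OF P T]) (use ab b in auto)
  qed
  then show ?thesis using I Pi(2) is_ideal_eq_UNIV[OF I] by (auto simp: prime_ideal_def)
qed

section \<open>Primitive, rational and locally closed in general\<close>

text \<open>With \<open>z = a/b\<close> central in the quotient field of \<open>B = A/P\<close>, the denominators of \<open>z\<close> form a
  Poisson ideal not inside \<open>P\<close>, so one of them is not in \<open>M\<close>; and \<open>zB \<inter> B\<close> is a Poisson ideal,
  which lies in \<open>M\<close> once \<open>z\<close> is translated to vanish at the point \<open>M\<close>.\<close>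

lemma primitive_imp_rational:
  assumes P: "poisson_prime pb P" and prim: "poisson_primitive pb P"
  shows "poisson_rational pb emb P"
  unfolding poisson_rational_def
proof (intro allI impI, elim conjE)
  fix a b assume b: "b \<notin> P" and c: "\<forall>c. pb a c * b - a * pb b c \<in> P"
  have Pi: "poisson_ideal pb P" using P by (auto simp: poisson_prime_def)
  note I = poisson_idealD(1)[OF Pi]
  note pr = poisson_prime_imp_prime[OF P]
  obtain M where M: "maximal_ideal M" "is_poisson_core pb M P"
    using prim by (auto simp: poisson_primitive_def)
  have Mp: "prime_ideal M" and Mi: "is_ideal M"
    using maximal_avoiding_prime[OF maximal_ideal_avoiding_one[OF M(1)]]
    by (auto dest: prime_idealD)
  have PM: "P \<subseteq> M" and core: "\<And>J. poisson_ideal pb J \<Longrightarrow> J \<subseteq> M \<Longrightarrow> J \<subseteq> P"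
    using M(2) by (auto simp: is_poisson_core_def)
  \<comment> \<open>\<open>?num a b\<close> holds the elements of \<open>B\<close> that are
    multiples of \<open>z = a/b\<close> by elements of \<open>B\<close>. Exchanging \<open>a\<close>
    and \<open>b\<close> yields the denominators of \<open>z\<close>.\<close>
  let ?num = "\<lambda>a b. {f. \<exists>g. f * b - a * g \<in> P}"
  have num: "poisson_ideal pb (?num a b)"
    if b: "b \<notin> P" and c: "\<forall>c. pb a c * b - a * pb b c \<in> P" for a b
  proof (rule poisson_idealI)
    show "0 \<in> ?num a b" using is_idealD(1)[OF I] by (auto intro: exI[of _ 0])
  next
    fix x y assume "x \<in> ?num a b" "y \<in> ?num a b"
    then obtain g h where "x * b - a * g \<in> P" "y * b - a * h \<in> P" by auto
    from is_idealD(2)[OF I this] have "(x + y) * b - a * (g + h) \<in> P"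
      by (simp add: algebra_simps)
    then show "x + y \<in> ?num a b" by blast
  next
    fix r x assume "x \<in> ?num a b"
    then obtain g where "x * b - a * g \<in> P" by auto
    from is_idealD(3)[OF I this, of r] have "(r * x) * b - a * (r * g) \<in> P"
      by (simp add: algebra_simps)
    then show "r * x \<in> ?num a b" by blast
  next
    fix x t assume "x \<in> ?num a b"
    then obtain g where g: "x * b - a * g \<in> P" by auto
    let ?w = "x * b - a * g"
    have "b * (pb x t * b - a * pb g t) = pb ?w t * b - pb b t * ?w + (pb a t * b - a * pb b t) * g"
      by (simp add: pb_mult_left pb_diff_left algebra_simps)
    also have "\<dots> \<in> P"
      by (rule is_idealD(2)[OF I is_ideal_diff[OF I]])
        (use g c in \<open>blast intro: is_idealD(3,4)[OF I] poisson_idealD(2)[OF Pi]\<close>)+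
    finally have "pb x t * b - a * pb g t \<in> P" using b prime_idealD(3)[OF pr] by blast
    then show "pb x t \<in> ?num a b" by blast
  qed
  show "\<exists>k. a - emb k * b \<in> P"
  proof (cases "a \<in> P")
    case True then show ?thesis by (intro exI[of _ 0]) (simp add: emb_0)
  next
    case False
    have "\<forall>c. pb b c * a - b * pb a c \<in> P"
    proof
      fix t show "pb b t * a - b * pb a t \<in> P"
        using is_ideal_uminus[OF I c[rule_format, of t]] by (simp add: mult.commute)
    qed
    from num[OF False this] have D: "poisson_ideal pb (?num b a)" .
    have "b \<in> ?num b a" using is_idealD(1)[OF I] by (auto intro: exI[of _ a])
    then obtain f g where f: "f \<notin> M" and fg: "f * a - b * g \<in> P"
      using core[OF D] b by blast
    obtain c1 c2 where c12: "g - emb c1 \<in> M" "f - emb c2 \<in> M"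
      using residue_scalar[OF maximal_ideal_avoiding_one[OF M(1)]] by blast
    have c2: "c2 \<noteq> 0" using c12(2) f by (auto simp: emb_0)
    \<comment> \<open>Modulo \<open>P\<close>, \<open>z\<close> equals \<open>g/f\<close> with
      \<open>f\<close> not in \<open>M\<close>, so \<open>k\<close> is the value of \<open>z\<close>
      at the point \<open>M\<close>.\<close>
    define k where "k = c1 / c2"
    have "emb k * emb c2 = emb c1" using c2 by (simp add: k_def flip: emb_mult)
    then have "g - emb k * f = (g - emb c1) - emb k * (f - emb c2)" by (simp add: algebra_simps)
    then have gk: "g - emb k * f \<in> M"
      using c12 is_ideal_diff[OF Mi] is_idealD(3)[OF Mi] by metis
    define a' where "a' = a - emb k * b"
    have "pb a' t * b - a' * pb b t = pb a t * b - a * pb b t" for t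
      by (simp add: a'_def pb_diff_left pb_mult_left pb_emb algebra_simps)
    then have "\<forall>t. pb a' t * b - a' * pb b t \<in> P" using c by simp
    from num[OF b this] have J: "poisson_ideal pb (?num a' b)" .
    have "?num a' b \<subseteq> M"
    proof
      fix x assume "x \<in> ?num a' b"
      then obtain h where h: "x * b - a' * h \<in> P" by auto
      \<comment> \<open>From \<open>x = (a'/b) h\<close> and \<open>a'/b = (g - k f)/f\<close>
        modulo \<open>P\<close> it follows that \<open>f x = (g - k f) h\<close>, which vanishes at
        \<open>M\<close>.\<close>
      have "b * (f * x - (g - emb k * f) * h) = f * (x * b - a' * h) + h * (f * a - b * g)"
        by (simp add: a'_def algebra_simps)
      also have "\<dots> \<in> P" using is_idealD(2)[OF I is_idealD(3)[OF I h] is_idealD(3)[OF I fg]] .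
      finally have "f * x - (g - emb k * f) * h \<in> M" using b prime_idealD(3)[OF pr] PM by blast
      then have "f * x \<in> M" using is_ideal_add_cancel[OF Mi] is_idealD(4)[OF Mi gk] by blast
      then show "x \<in> M" using f prime_idealD(3)[OF Mp] by blast
    qed
    moreover have "a' \<in> ?num a' b" using is_idealD(1)[OF I] by (auto intro: exI[of _ b])
    ultimately show ?thesis using core[OF J] unfolding a'_def by blast
  qed
qed

text \<open>Take \<open>e\<close> outside \<open>P\<close> that lies in all larger Poisson primes,
  and \<open>M\<close> above \<open>P\<close> maximal for avoiding the powers of \<open>e\<close>.
  Residues modulo \<open>M\<close> are scalars, so \<open>M\<close> is a maximal ideal; its core is
  a Poisson prime that contains \<open>P\<close> but not \<open>e\<close>, hence it is
  \<open>P\<close>.\<close>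

lemma locally_closed_imp_primitive:
  assumes P: "poisson_prime pb P" and lc: "poisson_locally_closed pb P"
  shows "poisson_primitive pb P"
proof -
  have Pi: "poisson_ideal pb P" using P by (auto simp: poisson_prime_def)
  note I = poisson_idealD(1)[OF Pi]
  have "P \<subseteq> \<Inter>{Q. poisson_prime pb Q \<and> P \<subset> Q}" by auto
  with lc have "P \<subset> \<Inter>{Q. poisson_prime pb Q \<and> P \<subset> Q}"
    unfolding poisson_locally_closed_def by (intro psubsetI) simp_all
  then obtain e where e: "e \<notin> P" "\<And>Q. poisson_prime pb Q \<Longrightarrow> P \<subset> Q \<Longrightarrow> e \<in> Q"
    by (auto dest!: psubset_imp_ex_mem)
  then have "e ^ k \<notin> P" for k using poisson_prime_radical[OF P] by blast
  then obtain M where M: "P \<subseteq> M" "maximal_avoiding e M"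
    using maximal_avoiding_exists[OF I] by blast
  note Mp = maximal_avoiding_prime[OF M(2)]
  note Mi = prime_idealD(1)[OF Mp]
  have "maximal_ideal M"
  proof (rule maximal_idealI[OF Mi prime_idealD(2)[OF Mp]])
    fix x assume x: "x \<notin> M"
    obtain c where c: "x - emb c \<in> M" using residue_scalar[OF M(2)] by blast
    have "c \<noteq> 0" using c x by (auto simp: emb_0)
    have "emb c * (1 - emb (inverse c) * x) = emb c - emb (c * inverse c) * x"
      by (simp add: emb_mult algebra_simps)
    also have "\<dots> = - (x - emb c)" using \<open>c \<noteq> 0\<close> by (simp add: emb_1)
    finally have "emb c * (1 - emb (inverse c) * x) \<in> M" using is_ideal_uminus[OF Mi c] by simp
    then show "\<exists>y. 1 - y * x \<in> M" using emb_cancel[OF Mi] \<open>c \<noteq> 0\<close> by blast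
  qed
  moreover obtain C where C: "is_poisson_core pb M C" using poisson_core_exists[OF Mi] .
  have "C = P"
  proof (rule ccontr)
    assume "C \<noteq> P"
    moreover have "P \<subseteq> C" "C \<subseteq> M" using C M(1) Pi by (auto simp: is_poisson_core_def)
    ultimately have "e \<in> M" using e(2)[OF poisson_prime_core[OF Mp C]] by blast
    then show False using M(2) unfolding maximal_avoiding_def by (metis power_one_right)
  qed
  ultimately show ?thesis using C by (auto simp: poisson_primitive_def)
qed

end

section \<open>Laurent monomials, and from rational to locally closed\<close>

definition monom_in :: "'a::comm_ring_1 set \<Rightarrow> ('a \<Rightarrow> nat) \<Rightarrow> 'a" where
  "monom_in Z k = (\<Prod>z\<in>Z. z ^ k z)"

lemma monom_in_mult: "monom_in Z k * monom_in Z l = monom_in Z (\<lambda>z. k z + l z)"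
  by (simp add: monom_in_def power_add prod.distrib)

lemma monom_in_0: "monom_in Z (\<lambda>_. 0) = 1"
  by (simp add: monom_in_def)

lemma monom_in_single:
  assumes "finite Z" "z \<in> Z" shows "monom_in Z (\<lambda>y. if y = z then 1 else 0) = z"
proof -
  have "monom_in Z (\<lambda>y. if y = z then 1 else 0) = (\<Prod>y\<in>Z. if y = z then z else 1)"
    unfolding monom_in_def by (intro prod.cong) auto
  then show ?thesis using assms by simp
qed

context affine_poisson
begin

definition monom_span :: "'a set \<Rightarrow> 'a set" where
  "monom_span Z = {\<Sum>k\<in>F. emb (a k) * monom_in Z k | F a. finite F}"

lemma monom_span_term: "emb c * monom_in Z k \<in> monom_span Z"
  unfolding monom_span_def by (auto intro!: exI[of _ "{k}"] exI[of _ "\<lambda>_. c"])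

lemma monom_span_add:
  assumes "s \<in> monom_span Z" "t \<in> monom_span Z" shows "s + t \<in> monom_span Z"
proof -
  obtain F a G b where *: "finite F" "s = (\<Sum>k\<in>F. emb (a k) * monom_in Z k)"
    "finite G" "t = (\<Sum>k\<in>G. emb (b k) * monom_in Z k)"
    using assms by (auto simp: monom_span_def)
  let ?a = "\<lambda>k. if k \<in> F then a k else 0" and ?b = "\<lambda>k. if k \<in> G then b k else 0"
  have "s = (\<Sum>k\<in>F\<union>G. emb (?a k) * monom_in Z k)"
    unfolding * by (intro sum.mono_neutral_cong_left) (use * in \<open>auto simp: emb_0\<close>)
  moreover have "t = (\<Sum>k\<in>F\<union>G. emb (?b k) * monom_in Z k)"
    unfolding * by (intro sum.mono_neutral_cong_left) (use * in \<open>auto simp: emb_0\<close>)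
  ultimately have "s + t = (\<Sum>k\<in>F\<union>G. emb (?a k + ?b k) * monom_in Z k)"
    by (simp add: emb_add distrib_right sum.distrib)
  then show ?thesis unfolding monom_span_def using * by (auto intro: exI[of _ "F \<union> G"])
qed

lemma monom_span_sum:
  "(\<And>x. x \<in> S \<Longrightarrow> f x \<in> monom_span Z) \<Longrightarrow> (\<Sum>x\<in>S. f x) \<in> monom_span Z"
  using monom_span_term[of 0] by (induction S rule: infinite_finite_induct)
    (auto simp: emb_0 monom_span_add)

lemma monom_span_mult:
  assumes "s \<in> monom_span Z" "t \<in> monom_span Z" shows "s * t \<in> monom_span Z"
proof -
  obtain F a G b where *: "finite F" "s = (\<Sum>k\<in>F. emb (a k) * monom_in Z k)"
    "finite G" "t = (\<Sum>k\<in>G. emb (b k) * monom_in Z k)"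
    using assms by (auto simp: monom_span_def)
  have "s * t = (\<Sum>k\<in>F. \<Sum>l\<in>G. emb (a k * b l) * monom_in Z (\<lambda>z. k z + l z))"
    unfolding * sum_product
    by (intro sum.cong refl) (simp add: emb_mult algebra_simps flip: monom_in_mult)
  then show ?thesis by (simp add: monom_span_sum monom_span_term)
qed

text \<open>For finite \<open>Z\<close> disjoint from a prime \<open>P\<close>, this is the preimage
  of the span of the Laurent monomials in \<open>Z\<close> inside the fraction field modulo
  \<open>P\<close>; \<open>k\<close> is a common denominator.\<close>

definition laurent_hull :: "'a set \<Rightarrow> 'a set \<Rightarrow> 'a set" where
  "laurent_hull P Z = {f. \<exists>k. \<exists>s\<in>monom_span Z. monom_in Z k * f - s \<in> P}"

lemma laurent_hullI: "s \<in> monom_span Z \<Longrightarrow> monom_in Z k * f - s \<in> P \<Longrightarrow> f \<in> laurent_hull P Z"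
  unfolding laurent_hull_def by blast

lemma laurent_hull_span:
  assumes "is_ideal P" "s \<in> monom_span Z" shows "s \<in> laurent_hull P Z"
  by (rule laurent_hullI[OF assms(2), of "\<lambda>_. 0"])
     (simp add: monom_in_0 is_idealD(1)[OF assms(1)])

lemma laurent_hull_scalar: "is_ideal P \<Longrightarrow> emb c \<in> laurent_hull P Z"
  using laurent_hull_span[OF _ monom_span_term[of c Z "\<lambda>_. 0"]] by (simp add: monom_in_0)

lemma laurent_hull_gen:
  assumes "is_ideal P" "finite Z" "z \<in> Z" shows "z \<in> laurent_hull P Z"
  using laurent_hull_span[OF assms(1) monom_span_term[of 1 _ "\<lambda>y. if y = z then 1 else 0"]]
    monom_in_single[OF assms(2,3)] by (metis emb_1 mult_1)

lemma laurent_hull_ideal: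
  assumes "is_ideal P" "f \<in> P" shows "f \<in> laurent_hull P Z"
  by (rule laurent_hullI[OF monom_span_term[of 0], of _ "\<lambda>_. 0"]) (simp add: monom_in_0 emb_0 assms)

lemma laurent_hull_mult:
  assumes I: "is_ideal P" and "f \<in> laurent_hull P Z" "g \<in> laurent_hull P Z"
  shows "f * g \<in> laurent_hull P Z"
proof -
  obtain k l s t where *: "s \<in> monom_span Z" "t \<in> monom_span Z"
    "monom_in Z k * f - s \<in> P" "monom_in Z l * g - t \<in> P"
    using assms by (auto simp: laurent_hull_def)
  have "monom_in Z (\<lambda>z. k z + l z) * (f * g) - s * t
      = (monom_in Z k * f - s) * (monom_in Z l * g) + s * (monom_in Z l * g - t)"
    by (simp add: algebra_simps flip: monom_in_mult)
  also have "\<dots> \<in> P" using is_idealD(2)[OF I is_idealD(4)[OF I *(3)] is_idealD(3)[OF I *(4)]] .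
  finally show ?thesis by (rule laurent_hullI[OF monom_span_mult[OF *(1,2)]])
qed

lemma laurent_hull_add:
  assumes I: "is_ideal P" and "f \<in> laurent_hull P Z" "g \<in> laurent_hull P Z"
  shows "f + g \<in> laurent_hull P Z"
proof -
  obtain k l s t where *: "s \<in> monom_span Z" "t \<in> monom_span Z"
    "monom_in Z k * f - s \<in> P" "monom_in Z l * g - t \<in> P"
    using assms by (auto simp: laurent_hull_def)
  have m: "monom_in Z j \<in> monom_span Z" for j using monom_span_term[of 1 Z j] by (simp add: emb_1)
  have "monom_in Z (\<lambda>z. k z + l z) * (f + g) - (monom_in Z l * s + monom_in Z k * t)
      = monom_in Z l * (monom_in Z k * f - s) + monom_in Z k * (monom_in Z l * g - t)"
    by (simp add: algebra_simps flip: monom_in_mult)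
  also have "\<dots> \<in> P" using is_idealD(2)[OF I is_idealD(3)[OF I *(3)] is_idealD(3)[OF I *(4)]] .
  finally show ?thesis
    by (rule laurent_hullI[OF monom_span_add[OF monom_span_mult[OF m *(1)] monom_span_mult[OF m *(2)]]])
qed

lemma laurent_hull_diff:
  assumes I: "is_ideal P" and "f \<in> laurent_hull P Z" "g \<in> laurent_hull P Z"
  shows "f - g \<in> laurent_hull P Z"
  using laurent_hull_add[OF I assms(2) laurent_hull_mult[OF I laurent_hull_scalar[OF I, of "- 1"] assms(3)]]
  by (simp add: emb_uminus emb_1)

lemma laurent_hull_cancel:
  assumes "is_ideal P" "finite Z" "z \<in> Z" "z * f \<in> laurent_hull P Z"
  shows "f \<in> laurent_hull P Z"
proof -
  obtain k s where *: "s \<in> monom_span Z" "monom_in Z k * (z * f) - s \<in> P"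
    using assms(4) by (auto simp: laurent_hull_def)
  have "monom_in Z k * z = monom_in Z (\<lambda>y. k y + (if y = z then 1 else 0))"
    using monom_in_mult[of Z k "\<lambda>y. if y = z then 1 else 0"] monom_in_single[OF assms(2,3)] by simp
  then have "monom_in Z (\<lambda>y. k y + (if y = z then 1 else 0)) * f - s \<in> P"
    using *(2) by (metis mult.assoc)
  then show ?thesis using *(1) by (rule laurent_hullI[rotated])
qed

definition monom_weight :: "('a \<Rightarrow> 'a \<Rightarrow> complex) \<Rightarrow> 'a set \<Rightarrow> ('a \<Rightarrow> nat) \<Rightarrow> 'a \<Rightarrow> complex" where
  "monom_weight c Z k z = (\<Sum>y\<in>Z. c z y * of_nat (k y))"

lemma pb_monom_in:
  assumes "finite Z" "z \<in> Z" and c: "\<And>z w. z \<in> Z \<Longrightarrow> w \<in> Z \<Longrightarrow> pb z w = emb (c z w) * z * w"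
  shows "pb z (monom_in Z k) = emb (monom_weight c Z k z) * z * monom_in Z k"
proof -
  have pw: "pb z (y ^ n) = emb (c z y * of_nat n) * z * y ^ n" if "y \<in> Z" for y n
  proof (induction n)
    case 0 then show ?case using pb_one_left[of z] pb_antisym[of z 1] by (simp add: emb_0)
  next
    case (Suc n) then show ?case
      by (simp add: pb_mult_right c[OF assms(2) that] emb_add distrib_left) (simp add: algebra_simps)
  qed
  have "pb z (\<Prod>y\<in>S. y ^ k y) = emb (\<Sum>y\<in>S. c z y * of_nat (k y)) * z * (\<Prod>y\<in>S. y ^ k y)"
    if "S \<subseteq> Z" for S
    using finite_subset[OF that assms(1)] that
  proof (induction S rule: finite_induct)
    case empty then show ?case using pb_one_left[of z] pb_antisym[of z 1] by (simp add: emb_0)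
  next
    case (insert y S) then show ?case
      by (simp add: pb_mult_right pw emb_add) (simp add: algebra_simps)
  qed
  then show ?thesis by (simp add: monom_in_def monom_weight_def)
qed

text \<open>If two monomials have the same weight, their quotient is central modulo \<open>P\<close>.\<close>

lemma equal_weight_proportional:
  assumes P: "poisson_prime pb P" and rat: "poisson_rational pb emb P"
    and Z: "finite Z" "\<And>z. z \<in> Z \<Longrightarrow> z \<notin> P"
    and c: "\<And>z w. z \<in> Z \<Longrightarrow> w \<in> Z \<Longrightarrow> pb z w = emb (c z w) * z * w"
    and dense: "\<And>f. f \<in> laurent_hull P Z"
    and w: "\<And>z. z \<in> Z \<Longrightarrow> monom_weight c Z k z = monom_weight c Z l z"
  obtains x where "monom_in Z k - emb x * monom_in Z l \<in> P"
proof -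
  have Pi: "poisson_ideal pb P" using P by (auto simp: poisson_prime_def)
  note I = poisson_idealD(1)[OF Pi]
  note pr = poisson_prime_imp_prime[OF P]
  have notP: "monom_in Z j \<notin> P" for j
    using prime_ideal_prod[OF pr Z(1), of "\<lambda>z. z ^ j z"] Z(2) prime_ideal_power[OF pr]
    unfolding monom_in_def by blast
  define a b where "a = monom_in Z k" and "b = monom_in Z l"
  \<comment> \<open>\<open>D t\<close> is \<open>b^2\<close> times the bracket of \<open>a/b\<close>
    with \<open>t\<close>, so \<open>D\<close> is a derivation. It vanishes on \<open>Z\<close>,
    hence on \<open>monom_span Z\<close>, and \<open>dense\<close> extends this to all
    \<open>t\<close> modulo \<open>P\<close>.\<close>
  define D where "D t = pb a t * b - a * pb b t" for t
  have D_mult: "D (s * t) = s * D t + D s * t" for s t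
    by (simp add: D_def pb_mult_right algebra_simps)
  have D_gen: "D z = 0" if "z \<in> Z" for z
    unfolding D_def pb_antisym[of _ z] a_def b_def
    by (simp add: pb_monom_in[OF Z(1) that c] w[OF that] algebra_simps)
  have D_emb: "D (emb x) = 0" for x
    using pb_emb[of x] pb_antisym[of _ "emb x"] by (simp add: D_def)
  have D_pow: "D (z ^ n) = 0" if "z \<in> Z" for z n
    using D_emb[of 1] by (induction n) (simp_all add: D_mult D_gen[OF that] emb_1)
  have D_prod: "D (\<Prod>z\<in>S. z ^ j z) = 0" if "S \<subseteq> Z" for S j
    using finite_subset[OF that Z(1)] that D_emb[of 1]
    by (induction S rule: finite_induct) (simp_all add: D_mult D_pow emb_1)
  have D_monom: "D (monom_in Z j) = 0" for j
    unfolding monom_in_def by (rule D_prod) simp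
  have D_span: "D s = 0" if "s \<in> monom_span Z" for s
  proof -
    have "D (\<Sum>k\<in>F. g k) = (\<Sum>k\<in>F. D (g k))" for g :: "('a \<Rightarrow> nat) \<Rightarrow> 'a" and F
      by (simp add: D_def pb_sum_right sum_subtractf sum_distrib_left sum_distrib_right)
    then show ?thesis using that by (auto simp: monom_span_def D_mult D_emb D_monom)
  qed
  have D_P: "D p \<in> P" if "p \<in> P" for p
    unfolding D_def using that
    by (intro is_ideal_diff[OF I] is_idealD(3)[OF I, of "pb b p"] is_idealD(4)[OF I, of "pb a p"]
        poisson_idealD(3)[OF Pi])
  have "D t \<in> P" for t
  proof -
    obtain j s where *: "s \<in> monom_span Z" "monom_in Z j * t - s \<in> P"
      using dense[of t] by (auto simp: laurent_hull_def)
    have "monom_in Z j * D t = D (monom_in Z j * t - s)"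
    proof -
      have "D (u - s) = D u - D s" for u by (simp add: D_def pb_diff_right algebra_simps)
      then show ?thesis by (simp add: D_mult D_monom D_span[OF *(1)])
    qed
    also have "\<dots> \<in> P" using D_P *(2) .
    finally show ?thesis using notP prime_idealD(3)[OF pr] by blast
  qed
  then show thesis
    using rat notP[of l] that unfolding poisson_rational_def D_def a_def b_def by blast
qed

text \<open>If \<open>Q\<close> misses the product of \<open>Z\<close>, take a shortest combination
  of monomials in \<open>Q\<close> but not in \<open>P\<close>. Bracketing with \<open>z\<close>
  scales each term by its weight and by \<open>z\<close>; subtracting the weight of one term removes
  that term, so by minimality the rest lies in \<open>P\<close>. This forces all weights to agree,
  the combination becomes a nonzero scalar times one monomial modulo \<open>P\<close>, and that
  monomial lies in \<open>Q\<close>, a contradiction.\<close>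

lemma rational_imp_locally_closed:
  assumes P: "poisson_prime pb P" and rat: "poisson_rational pb emb P"
    and Z: "finite Z" "\<And>z. z \<in> Z \<Longrightarrow> z \<notin> P"
    and c: "\<And>z w. z \<in> Z \<Longrightarrow> w \<in> Z \<Longrightarrow> pb z w = emb (c z w) * z * w"
    and dense: "\<And>f. f \<in> laurent_hull P Z"
  shows "poisson_locally_closed pb P"
proof -
  have Pi: "poisson_ideal pb P" using P by (auto simp: poisson_prime_def)
  note I = poisson_idealD(1)[OF Pi]
  note pr = poisson_prime_imp_prime[OF P]
  have "\<Prod>Z \<in> Q" if Q: "poisson_prime pb Q" and PQ: "P \<subset> Q" for Q
  proof (rule ccontr)
    assume e: "\<Prod>Z \<notin> Q"
    have Qi: "poisson_ideal pb Q" using Q by (auto simp: poisson_prime_def)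
    note J = poisson_idealD(1)[OF Qi]
    note Qpr = poisson_prime_imp_prime[OF Q]
    have ZQ: "z \<notin> Q" if "z \<in> Z" for z
      using e is_idealD(4)[OF J, of z] prod.remove[OF Z(1) that, of "\<lambda>x. x"] by auto
    have notQ: "monom_in Z j \<notin> Q" for j
      using prime_ideal_prod[OF Qpr Z(1), of "\<lambda>z. z ^ j z"] ZQ prime_ideal_power[OF Qpr]
      unfolding monom_in_def by blast
    define S where "S F a = (\<Sum>k\<in>F. emb (a k) * monom_in Z k)" for F a
    \<comment> \<open>Length counts exponent functions. Different ones may give the same element of
      the ring, so length belongs to an expression and not to its value.\<close>
    define ok where "ok n \<longleftrightarrow> (\<exists>F a. finite F \<and> card F = n \<and> S F a \<in> Q \<and> S F a \<notin> P)" for n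
    have "\<exists>n. ok n"
    proof -
      obtain f where f: "f \<in> Q" "f \<notin> P" using PQ by blast
      obtain k s where *: "s \<in> monom_span Z" "monom_in Z k * f - s \<in> P"
        using dense[of f] by (auto simp: laurent_hull_def)
      have "s \<in> Q"
        using is_ideal_add_cancel[OF J, of "monom_in Z k * f" s] * PQ is_idealD(3)[OF J f(1)] by blast
      moreover have "s \<notin> P"
        using is_ideal_add_cancel[OF I *(2)] prime_idealD(3)[OF pr, of _ f] f(2) notQ PQ by blast
      ultimately show ?thesis using *(1) unfolding ok_def monom_span_def S_def by blast
    qed
    then have "ok (LEAST n. ok n)" by (rule LeastI_ex)
    then obtain F a where F: "finite F" "card F = (LEAST n. ok n)" and SQ: "S F a \<in> Q" and SP: "S F a \<notin> P"
      unfolding ok_def by blast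
    have small: "S G b \<in> P" if "finite G" "card G < card F" "S G b \<in> Q" for G b
    proof (rule ccontr)
      assume "S G b \<notin> P"
      then have "ok (card G)" using that unfolding ok_def by blast
      then show False using not_less_Least[of "card G" ok] that(2) F(2) by simp
    qed
    have smaller: "S F (\<lambda>k. (monom_weight c Z k z - monom_weight c Z k0 z) * a k) \<in> P"
      if "z \<in> Z" "k0 \<in> F" for z k0
    proof -
      let ?b = "\<lambda>k. (monom_weight c Z k z - monom_weight c Z k0 z) * a k"
      have eq: "S F ?b = S (F - {k0}) ?b"
        unfolding S_def using F(1) that by (subst sum.remove[of F k0]) (auto simp: emb_0)
      have "pb z (S F a) = (\<Sum>k\<in>F. z * (emb (monom_weight c Z k z * a k) * monom_in Z k))"
        unfolding S_def pb_sum_right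
        by (intro sum.cong refl)
           (use pb_emb pb_antisym[of z "emb _"] in
             \<open>simp add: pb_mult_right pb_monom_in[OF Z(1) that(1) c] emb_mult algebra_simps\<close>)
      then have "z * S F ?b = pb z (S F a) - emb (monom_weight c Z k0 z) * z * S F a"
        by (simp add: S_def sum_distrib_left emb_mult emb_diff algebra_simps sum_subtractf)
      also have "\<dots> \<in> Q" using SQ is_ideal_diff[OF J] is_idealD(3)[OF J] poisson_idealD(3)[OF Qi] by blast
      finally have "S F ?b \<in> Q" using ZQ[OF that(1)] prime_idealD(3)[OF Qpr] by blast
      then show ?thesis
        using small[of "F - {k0}" ?b] F(1) card_Diff1_less[OF F(1) that(2)] unfolding eq by simp
    qed
    have same: "monom_weight c Z k z = monom_weight c Z l z" if "k \<in> F" "l \<in> F" "z \<in> Z" for k l z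
    proof (rule ccontr)
      assume ne: "monom_weight c Z k z \<noteq> monom_weight c Z l z"
      \<comment> \<open>The shortened sums that omit \<open>l\<close> and \<open>k\<close> differ by
        a scalar multiple of the whole sum.\<close>
      have "emb (monom_weight c Z k z - monom_weight c Z l z) * S F a \<in> P"
        using is_ideal_diff[OF I smaller[OF that(3,2)] smaller[OF that(3,1)]]
        by (simp add: S_def sum_distrib_left emb_mult emb_diff algebra_simps sum_subtractf)
      then show False using emb_cancel[OF I] ne SP by auto
    qed
    have "F \<noteq> {}" using SP is_idealD(1)[OF I] by (auto simp: S_def)
    then obtain l where l: "l \<in> F" by blast
    have "\<exists>x. monom_in Z k - emb x * monom_in Z l \<in> P" if "k \<in> F" for k
      using equal_weight_proportional[OF P rat Z c dense same[OF that l]] by blast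
    then obtain x where x: "\<And>k. k \<in> F \<Longrightarrow> monom_in Z k - emb (x k) * monom_in Z l \<in> P" by metis
    let ?C = "\<Sum>k\<in>F. a k * x k"
    have embsum: "emb (\<Sum>k\<in>G. h k) = (\<Sum>k\<in>G. emb (h k))" for G and h :: "('a \<Rightarrow> nat) \<Rightarrow> complex"
      by (induction G rule: infinite_finite_induct) (simp_all add: emb_0 emb_add)
    have "S F a - emb ?C * monom_in Z l = (\<Sum>k\<in>F. emb (a k) * (monom_in Z k - emb (x k) * monom_in Z l))"
      by (simp add: S_def embsum sum_distrib_right sum_distrib_left emb_mult algebra_simps sum_subtractf)
    also have "\<dots> \<in> P" using x is_idealD(3)[OF I] by (intro is_ideal_sum[OF I]) blast
    finally have d: "S F a - emb ?C * monom_in Z l \<in> P" .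
    then have "emb ?C * monom_in Z l \<in> Q"
      using is_ideal_add_cancel[OF J] PQ SQ by blast
    moreover have "?C \<noteq> 0" using is_ideal_add_cancel[OF I d] SP is_idealD(1)[OF I] by (auto simp: emb_0)
    ultimately show False using emb_cancel[OF J] notQ by blast
  qed
  moreover have "\<Prod>Z \<notin> P" using prime_ideal_prod[OF pr Z(1), of "\<lambda>z. z"] Z(2) by blast
  ultimately show ?thesis unfolding poisson_locally_closed_def by blast
qed

end

section \<open>Polynomials as finitely supported functions\<close>

lemma poly_mapping_sum_single:
  "(\<Sum>m\<in>Poly_Mapping.keys p. Poly_Mapping.single m (Poly_Mapping.lookup p m)) = p"
  by (rule poly_mapping_eqI)
     (auto simp: lookup_sum lookup_single when_def sum.delta' in_keys_iff sum.If_cases)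

lemma poly_mapping_single_induct [case_names single add]:
  assumes "\<And>m c. Q (Poly_Mapping.single m c)" "\<And>p q. Q p \<Longrightarrow> Q q \<Longrightarrow> Q (p + q)"
  shows "Q (p :: 'a \<Rightarrow>\<^sub>0 'b::comm_monoid_add)"
proof -
  have "Q (\<Sum>m\<in>F. Poly_Mapping.single m (Poly_Mapping.lookup p m))" for F
    using assms(1)[of undefined 0] by (induction F rule: infinite_finite_induct) (auto intro: assms)
  from this[of "Poly_Mapping.keys p"] show ?thesis by (simp only: poly_mapping_sum_single)
qed

lemma lookup_single_mult:
  fixes p :: "'a::cancel_comm_monoid_add \<Rightarrow>\<^sub>0 'b::comm_semiring_1"
  shows "Poly_Mapping.lookup (Poly_Mapping.single m c * p) (m + k) = c * Poly_Mapping.lookup p k"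
  by (induction p rule: poly_mapping_single_induct)
     (auto simp: mult_single lookup_single when_def lookup_add distrib_left)

lemma lookup_pconst_mult: "Poly_Mapping.lookup (pconst c * p) k = c * Poly_Mapping.lookup p k"
  using lookup_single_mult[of 0 c p k] by (simp add: pconst_def)

lemma pconst_simps:
  "pconst 0 = 0" "pconst 1 = 1" "pconst (x + y) = pconst x + pconst y"
  "pconst (x * y) = pconst x * pconst y" "pconst (- x) = - pconst x" "pconst (x - y) = pconst x - pconst y"
  by (simp_all add: pconst_def single_add mult_single single_uminus single_diff)

lemma cpoly_closure:
  assumes "\<And>c. pconst c \<in> S" "\<And>v. pvar v \<in> S"
    and "\<And>p q. p \<in> S \<Longrightarrow> q \<in> S \<Longrightarrow> p + q \<in> S" "\<And>p q. p \<in> S \<Longrightarrow> q \<in> S \<Longrightarrow> p * q \<in> S"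
  shows "p \<in> S"
proof (induction p rule: poly_mapping_single_induct)
  case (single m c)
  have pw: "Poly_Mapping.single (Poly_Mapping.single v n) 1 \<in> S" for v and n :: nat
  proof (induction n)
    case 0 then show ?case using assms(1)[of 1] by (simp add: pconst_def)
  next
    case (Suc n)
    have "pvar v * Poly_Mapping.single (Poly_Mapping.single v n) 1
        = Poly_Mapping.single (Poly_Mapping.single v (Suc n)) 1"
      by (simp add: pvar_def mult_single flip: single_add)
    then show ?case using assms(4)[OF assms(2) Suc, of v] by simp
  qed
  have "Poly_Mapping.single m 1 \<in> S"
  proof (induction m rule: poly_mapping_single_induct)
    case (single v n) then show ?case by (rule pw)
  next
    case (add p q) then show ?case using assms(4)[OF add] by (simp add: mult_single)
  qed
  then show ?case using assms(4)[OF assms(1)[of c]] by (fastforce simp: pconst_def mult_single)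
next
  case (add p q) then show ?case by (rule assms(3))
qed

section \<open>Partial derivatives and the bracket defined by its values on generators\<close>

lemma pderiv_var_superset:
  assumes "finite K" "Poly_Mapping.keys p \<subseteq> K"
  shows "pderiv_var v p = (\<Sum>m\<in>K. Poly_Mapping.single (m - Poly_Mapping.single v 1)
      (Poly_Mapping.lookup p m * of_nat (Poly_Mapping.lookup m v)))"
  unfolding pderiv_var_def
  by (rule sum.mono_neutral_left) (use assms in \<open>auto simp: in_keys_iff\<close>)

lemma pderiv_var_add: "pderiv_var v (p + q) = pderiv_var v p + pderiv_var v q"
proof -
  let ?K = "Poly_Mapping.keys p \<union> Poly_Mapping.keys q"
  have "Poly_Mapping.keys (p + q) \<subseteq> ?K" by (rule keys_add)
  then show ?thesis
    by (subst (1 2 3) pderiv_var_superset[of ?K])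
       (simp_all add: lookup_add distrib_right single_add sum.distrib)
qed

lemma pderiv_var_single:
  "pderiv_var v (Poly_Mapping.single m c) =
     Poly_Mapping.single (m - Poly_Mapping.single v 1) (c * of_nat (Poly_Mapping.lookup m v))"
  by (subst pderiv_var_superset[of "{m}"]) auto

lemma pderiv_var_mult: "pderiv_var v (p * q) = p * pderiv_var v q + pderiv_var v p * q"
proof (induction p rule: poly_mapping_single_induct)
  case (single m c)
  show ?case
  proof (induction q rule: poly_mapping_single_induct)
    case (single n d)
    let ?e = "Poly_Mapping.single v (1::nat)"
    \<comment> \<open>Subtraction of exponents is truncated, so it can be moved across a sum only
      where \<open>v\<close> occurs. Where it does not, the coefficient of the derivative is
      zero.\<close>
    have sh: "k + (l - ?e) = k + l - ?e" if "Poly_Mapping.lookup l v \<noteq> 0" for k l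
      using that by (intro poly_mapping_eqI) (auto simp: lookup_add lookup_minus lookup_single when_def)
    have "Poly_Mapping.single m c * pderiv_var v (Poly_Mapping.single n d) =
        Poly_Mapping.single (m + n - ?e) (c * d * of_nat (Poly_Mapping.lookup n v))"
      by (cases "Poly_Mapping.lookup n v = 0") (simp_all add: pderiv_var_single mult_single sh mult_ac del: One_nat_def)
    moreover have "pderiv_var v (Poly_Mapping.single m c) * Poly_Mapping.single n d =
        Poly_Mapping.single (m + n - ?e) (c * d * of_nat (Poly_Mapping.lookup m v))"
      using sh[of m n] by (cases "Poly_Mapping.lookup m v = 0")
        (simp_all add: pderiv_var_single mult_single mult_ac add.commute del: One_nat_def)
    ultimately show ?case
      by (simp add: mult_single pderiv_var_single lookup_add flip: single_add)
         (simp add: algebra_simps)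
  next
    case (add p q) then show ?case by (simp add: distrib_left pderiv_var_add algebra_simps)
  qed
next
  case (add p q) then show ?case by (simp add: distrib_right pderiv_var_add algebra_simps)
qed

lemma pderiv_var_pvar: "pderiv_var v (pvar w) = (if v = w then 1 else 0)"
  by (simp add: pvar_def pderiv_var_single lookup_single when_def)

lemma pderiv_var_pconst: "pderiv_var v (pconst c) = 0"
  by (simp add: pconst_def pderiv_var_single)

lemma bracket_pvar: "bracket_from_gens gb (pvar a) (pvar b) = gb a b"
proof -
  have "bracket_from_gens gb (pvar a) (pvar b) = (\<Sum>x\<in>UNIV. if x = a then gb a b else 0)"
    unfolding bracket_from_gens_def pderiv_var_pvar
    by (intro sum.cong refl) (auto simp: sum.delta' if_distrib[of "\<lambda>x. x * _"] cong: if_cong)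
  then show ?thesis by simp
qed

lemma bracket_pconst: "bracket_from_gens gb (pconst c) p = 0"
  by (simp add: bracket_from_gens_def pderiv_var_pconst)

lemma pre_poisson_bracket:
  assumes "\<And>a b. gb a b = - gb b a" shows "pre_poisson (bracket_from_gens gb)"
proof
  fix p q s
  show "bracket_from_gens gb (p + q) s = bracket_from_gens gb p s + bracket_from_gens gb q s"
    by (simp add: bracket_from_gens_def pderiv_var_add distrib_right sum.distrib)
  show "bracket_from_gens gb (p * q) s = p * bracket_from_gens gb q s + bracket_from_gens gb p s * q"
    by (simp add: bracket_from_gens_def pderiv_var_mult sum.distrib
        sum_distrib_left sum_distrib_right algebra_simps)
  have "bracket_from_gens gb p q = (\<Sum>b\<in>UNIV. \<Sum>a\<in>UNIV. pderiv_var a p * pderiv_var b q * gb a b)"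
    unfolding bracket_from_gens_def by (rule sum.swap)
  also have "\<dots> = - bracket_from_gens gb q p"
    unfolding bracket_from_gens_def sum_negf[symmetric]
    by (intro sum.cong refl) (subst assms, simp add: mult_ac)
  finally show "bracket_from_gens gb p q = - bracket_from_gens gb q p" .
qed

section \<open>Hilbert's basis theorem\<close>

lemma nat_incseq_subseq:
  fixes s :: "nat \<Rightarrow> nat"
  obtains r where "strict_mono r" "incseq (\<lambda>n. s (r n))"
proof -
  obtain r where r: "strict_mono r" "monoseq (\<lambda>n. s (r n))" using seq_monosub[of s] by auto
  show thesis
  proof (cases "incseq (\<lambda>n. s (r n))")
    case True then show thesis using r that by blast
  next
    case False
    then have dec: "decseq (\<lambda>n. s (r n))" using r by (auto simp: monoseq_iff)
    \<comment> \<open>A decreasing sequence of naturals is constant from the index of its minimum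
      on.\<close>
    obtain N where N: "\<And>n. s (r N) \<le> s (r n)"
      using ex_has_least_nat[of "\<lambda>_. True" 0 "\<lambda>n. s (r n)"] by auto
    have "s (r (N + n)) = s (r N)" for n
      using N[of "N + n"] decseqD[OF dec, of N "N + n"] by simp
    then have "incseq (\<lambda>n. s (r (N + n)))" by (simp add: incseq_def)
    moreover have "strict_mono (\<lambda>n. r (N + n))" using r(1) by (simp add: strict_mono_def)
    ultimately show thesis using that[of "\<lambda>n. r (N + n)"] by simp
  qed
qed

definition divides_monom :: "('v \<Rightarrow>\<^sub>0 nat) \<Rightarrow> ('v \<Rightarrow>\<^sub>0 nat) \<Rightarrow> bool" where
  "divides_monom m n \<longleftrightarrow> (\<forall>v. Poly_Mapping.lookup m v \<le> Poly_Mapping.lookup n v)"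

text \<open>Passing to a subsequence for one variable after another makes every exponent
  nondecreasing; then the first two terms are comparable.\<close>

lemma dickson_sequence:
  fixes f :: "nat \<Rightarrow> ('v::finite \<Rightarrow>\<^sub>0 nat)"
  obtains i j where "i < j" "divides_monom (f i) (f j)"
proof -
  have "\<exists>r. strict_mono r \<and> (\<forall>v\<in>S. incseq (\<lambda>n. Poly_Mapping.lookup (f (r n)) v))" if "finite S" for S
    using that
  proof (induction S rule: finite_induct)
    case empty then show ?case using strict_mono_id by (auto intro: exI[of _ id])
  next
    case (insert v S)
    then obtain r where r: "strict_mono r" "\<forall>v\<in>S. incseq (\<lambda>n. Poly_Mapping.lookup (f (r n)) v)" by blast
    obtain t where t: "strict_mono t" "incseq (\<lambda>n. Poly_Mapping.lookup (f (r (t n))) v)"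
      using nat_incseq_subseq[of "\<lambda>n. Poly_Mapping.lookup (f (r n)) v"] by blast
    have "strict_mono (\<lambda>n. r (t n))" using r(1) t(1) by (simp add: strict_mono_def)
    moreover have "incseq (\<lambda>n. Poly_Mapping.lookup (f (r (t n))) w)" if "w \<in> insert v S" for w
    proof (cases "w = v")
      case False
      then have "incseq (\<lambda>n. Poly_Mapping.lookup (f (r n)) w)" using that r(2) by blast
      then show ?thesis using strict_mono_mono[OF t(1)] by (auto simp: incseq_def mono_def)
    qed (use t in simp)
    ultimately show ?case by blast
  qed
  from this[of UNIV] obtain r where "strict_mono r" "\<And>v. incseq (\<lambda>n. Poly_Mapping.lookup (f (r n)) v)"
    by auto
  then show thesis
    using that[of "r 0" "r 1"] by (simp add: divides_monom_def strict_mono_def incseq_def)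
qed

text \<open>\<open>D\<close> consists of the minimal monomials of \<open>S\<close>. They are
  pairwise incomparable, so an infinite set of them would contradict
  \<open>dickson_sequence\<close>.\<close>

lemma dickson_finite:
  fixes S :: "('v::finite \<Rightarrow>\<^sub>0 nat) set"
  obtains D where "finite D" "D \<subseteq> S" "\<And>m. m \<in> S \<Longrightarrow> \<exists>d\<in>D. divides_monom d m"
proof -
  let ?D = "{m\<in>S. \<forall>n\<in>S. divides_monom n m \<longrightarrow> n = m}"
  have "finite ?D"
  proof (rule ccontr)
    assume "infinite ?D"
    then obtain f :: "nat \<Rightarrow> _" where f: "inj f" "range f \<subseteq> ?D"
      using infinite_countable_subset by blast
    obtain i j where ij: "i < j" "divides_monom (f i) (f j)" by (rule dickson_sequence)
    moreover have "f i \<in> S" "f j \<in> ?D" using f(2) by auto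
    ultimately have "f i = f j" by blast
    then show False using f(1) ij(1) by (simp add: inj_eq)
  qed
  moreover have "\<exists>d\<in>?D. divides_monom d m" if "m \<in> S" for m
    using that
  proof (induction "\<Sum>v\<in>UNIV. Poly_Mapping.lookup m v" arbitrary: m rule: less_induct)
    case less
    show ?case
    proof (cases "m \<in> ?D")
      case True then show ?thesis by (auto simp: divides_monom_def)
    next
      case False
      then obtain n where n: "n \<in> S" "divides_monom n m" "n \<noteq> m" using less.prems by auto
      then obtain v where "Poly_Mapping.lookup n v \<noteq> Poly_Mapping.lookup m v"
        using poly_mapping_eqI[of n m] by blast
      then have "Poly_Mapping.lookup n v < Poly_Mapping.lookup m v"
        using n(2) unfolding divides_monom_def by (metis le_neq_implies_less)
      then have "(\<Sum>v\<in>UNIV. Poly_Mapping.lookup n v) < (\<Sum>v\<in>UNIV. Poly_Mapping.lookup m v)"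
        using n(2) by (intro sum_strict_mono_ex1) (auto simp: divides_monom_def)
      then obtain d where "d \<in> ?D" "divides_monom d n" using less.hyps[of n] n(1) by blast
      then show ?thesis using n(2) by (auto simp: divides_monom_def intro: order_trans)
    qed
  qed
  ultimately show thesis by (intro that[of ?D]) auto
qed

text \<open>The order on exponent vectors is lexicographic. It is compatible with addition and
  nothing lies below 0, so it is a monomial order refining divisibility.\<close>

lemma divides_monom_imp_le:
  fixes m n :: "'v::linorder \<Rightarrow>\<^sub>0 nat"
  assumes "divides_monom m n" shows "m \<le> n"
proof -
  have "\<not> n - m < 0" by transfer (simp add: less_fun_def)
  moreover have "n = m + (n - m)"
    using assms by (intro poly_mapping_eqI) (simp add: divides_monom_def lookup_add lookup_minus)
  ultimately show ?thesis using add_left_mono[of 0 "n - m" m] by simp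
qed

text \<open>In a descending chain Dickson's lemma finds a term that divides a later, hence smaller,
  one.\<close>

lemma wf_monom_less: "wf {(m, n :: 'v::{finite,linorder} \<Rightarrow>\<^sub>0 nat). m < n}"
  unfolding wf_iff_no_infinite_down_chain
proof
  assume "\<exists>f. \<forall>i. (f (Suc i), f i) \<in> {(m, n :: 'v \<Rightarrow>\<^sub>0 nat). m < n}"
  then obtain f :: "nat \<Rightarrow> 'v \<Rightarrow>\<^sub>0 nat" where f: "\<And>i. f (Suc i) < f i" by auto
  have dec: "f j < f i" if "i < j" for i j
    using that by (induction j) (auto elim!: less_SucE intro: f less_trans)
  obtain i j where "i < j" "divides_monom (f i) (f j)" by (rule dickson_sequence)
  then show False using dec[of i j] divides_monom_imp_le[of "f i" "f j"] by auto
qed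

text \<open>The generators are elements of \<open>I\<close> that realize the minimal leading
  monomials. Cancelling a leading term against one of them leaves an element of \<open>I\<close>
  that is zero or has a smaller leading monomial.\<close>

lemma hilbert_basis:
  fixes I :: "'v::{finite,linorder} cpoly set"
  assumes I: "is_ideal I"
  shows "\<exists>G. finite G \<and> G \<subseteq> I \<and> (\<forall>J. is_ideal J \<longrightarrow> G \<subseteq> J \<longrightarrow> I \<subseteq> J)"
proof -
  define lm :: "'v cpoly \<Rightarrow> _" where "lm p = Max (Poly_Mapping.keys p)" for p
  have lm: "Poly_Mapping.lookup p (lm p) \<noteq> 0" "\<And>k. k \<in> Poly_Mapping.keys p \<Longrightarrow> k \<le> lm p"
    if "p \<noteq> 0" for p
    using Max_in[of "Poly_Mapping.keys p"] that by (auto simp: lm_def in_keys_iff)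
  obtain D where D: "finite D" "D \<subseteq> lm ` (I - {0})"
    "\<And>m. m \<in> lm ` (I - {0}) \<Longrightarrow> \<exists>d\<in>D. divides_monom d m"
    by (rule dickson_finite) blast
  have "\<forall>d\<in>D. \<exists>p. p \<in> I \<and> p \<noteq> 0 \<and> lm p = d" using D(2) by blast
  then obtain b where b: "\<And>d. d \<in> D \<Longrightarrow> b d \<in> I \<and> b d \<noteq> 0 \<and> lm (b d) = d" by metis
  have "f \<in> J" if J: "is_ideal J" "b ` D \<subseteq> J" and "f \<in> I" for J f
    using that(3)
  proof (induction "lm f" arbitrary: f rule: wf_induct_rule[OF wf_monom_less])
    case (1 f)
    show ?case
    proof (cases "f = 0")
      case True then show ?thesis using is_idealD(1)[OF J(1)] by simp
    next
      case False
      then obtain d where d: "d \<in> D" "divides_monom d (lm f)" using D(3)[of "lm f"] 1(2) by blast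
      have bd: "b d \<in> I" "b d \<noteq> 0" "lm (b d) = d" using b[OF d(1)] by auto
      define m where "m = lm f - d"
      have md: "m + d = lm f"
        using d(2) by (intro poly_mapping_eqI) (simp add: m_def divides_monom_def lookup_add lookup_minus)
      define c where "c = Poly_Mapping.lookup f (lm f) / Poly_Mapping.lookup (b d) d"
      define h where "h = f - Poly_Mapping.single m c * b d"
      have hI: "h \<in> I" unfolding h_def
        using is_ideal_diff[OF I 1(2) is_idealD(3)[OF I bd(1)]] .
      have h0: "Poly_Mapping.lookup h (lm f) = 0"
        using lookup_single_mult[of m c "b d" d] lm(1)[OF bd(2)] bd(3)
        by (simp add: h_def lookup_minus md c_def)
      have "k \<le> lm f" if "k \<in> Poly_Mapping.keys h" for k
      proof -
        have "k \<in> Poly_Mapping.keys f \<or> k \<in> Poly_Mapping.keys (Poly_Mapping.single m c * b d)"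
          using that by (auto simp: h_def in_keys_iff lookup_minus)
        then show ?thesis
        proof
          assume "k \<in> Poly_Mapping.keys (Poly_Mapping.single m c * b d)"
          then obtain j where "j \<in> Poly_Mapping.keys (b d)" "k = m + j"
            using keys_mult[of "Poly_Mapping.single m c" "b d"] by (auto split: if_splits)
          then show ?thesis using lm(2)[OF bd(2)] bd(3) md by (metis add_left_mono)
        qed (use lm(2)[OF False] in blast)
      qed
      then have "h \<noteq> 0 \<Longrightarrow> lm h < lm f"
        using lm(1)[of h] h0 by (metis in_keys_iff order_le_imp_less_or_eq)
      then have "h \<in> J" using 1(1)[of h] hI is_idealD(1)[OF J(1)] by auto
      moreover have "Poly_Mapping.single m c * b d \<in> J" using J d(1) is_idealD(3) by blast
      ultimately have "h + Poly_Mapping.single m c * b d \<in> J" using is_idealD(2)[OF J(1)] by blast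
      then show ?thesis by (simp add: h_def)
    qed
  qed
  then show ?thesis using D(1) b by (intro exI[of _ "b ` D"]) auto
qed

section \<open>Residue fields\<close>

text \<open>Gaussian elimination: an unknown \<open>c0\<close> occurring in equation
  \<open>k\<close> is eliminated from the remaining equations.\<close>

lemma linear_dependence:
  fixes g :: "'c \<Rightarrow> 'k \<Rightarrow> 'f::field"
  assumes "finite K" "finite F" "card K < card F"
  shows "\<exists>a. (\<exists>c\<in>F. a c \<noteq> 0) \<and> (\<forall>k\<in>K. (\<Sum>c\<in>F. a c * g c k) = 0)"
  using assms
proof (induction K arbitrary: F g rule: finite_induct)
  case empty then show ?case by (intro exI[of _ "\<lambda>_. 1"]) (auto simp: card_gt_0_iff)
next
  case (insert k K)
  show ?case
  proof (cases "\<forall>c\<in>F. g c k = 0")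
    case True
    have "card K < card F" using insert by simp
    then show ?thesis using insert.IH[OF insert.prems(1), of g] True by auto
  next
    case False
    then obtain c0 where c0: "c0 \<in> F" "g c0 k \<noteq> 0" by auto
    let ?F = "F - {c0}"
    have "card K < card ?F" using insert c0 by simp
    then obtain a where a: "\<exists>c\<in>?F. a c \<noteq> 0"
      "\<forall>j\<in>K. (\<Sum>c\<in>?F. a c * (g c j - g c k / g c0 k * g c0 j)) = 0"
      using insert.IH[of ?F "\<lambda>c j. g c j - g c k / g c0 k * g c0 j"] insert.prems(1) by blast
    \<comment> \<open>The coefficient \<open>- s\<close> of \<open>c0\<close> is the one that makes
      equation \<open>k\<close> hold.\<close>
    define s where "s = (\<Sum>c\<in>?F. a c * g c k) / g c0 k"
    define a' where "a' = a(c0 := - s)"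
    have split: "(\<Sum>c\<in>F. a' c * g c j) = (\<Sum>c\<in>?F. a c * g c j) - s * g c0 j" for j
      using insert.prems(1) c0(1) by (subst sum.remove[of F c0]) (auto simp: a'_def)
    have "(\<Sum>c\<in>F. a' c * g c j) = 0" if "j \<in> insert k K" for j
    proof (cases "j = k")
      case True then show ?thesis using c0 by (simp add: split s_def)
    next
      case False
      then have "(\<Sum>c\<in>?F. a c * (g c j - g c k / g c0 k * g c0 j)) = 0" using a(2) that by blast
      then show ?thesis
        by (simp add: split s_def sum_divide_distrib sum_distrib_right sum_distrib_left sum_subtractf algebra_simps)
    qed
    moreover have "\<exists>c\<in>F. a' c \<noteq> 0" using a(1) by (auto simp: a'_def)
    ultimately show ?thesis by blast
  qed
qed

lemma infinite_fibre:
  fixes h :: "complex \<Rightarrow> 'b::countable"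
  obtains y where "infinite {c. h c = y}"
proof -
  have "\<exists>y. infinite {c. h c = y}"
  proof (rule ccontr)
    assume "\<nexists>y. infinite {c. h c = y}"
    then have "countable (\<Union>y. {c. h c = y})" by (intro countable_UN) (auto intro: countable_finite)
    moreover have "(\<Union>y. {c. h c = y}) = UNIV" by auto
    ultimately show False using uncountable_UNIV_complex by simp
  qed
  then show thesis using that by blast
qed

section \<open>Evaluation of one-variable polynomials, and scalar residues\<close>

definition peval :: "'v cpoly \<Rightarrow> complex poly \<Rightarrow> 'v cpoly" where
  "peval f h = poly (map_poly pconst h) f"

lemma peval_pCons: "peval f (pCons c h) = pconst c + f * peval f h"
  by (simp add: peval_def map_poly_pCons pconst_simps)

lemma peval_0: "peval f 0 = 0"
  by (simp add: peval_def)

lemma peval_add: "peval f (g + h) = peval f g + peval f h"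
proof (induction g arbitrary: h)
  case (pCons a g)
  then show ?case by (cases h) (simp add: peval_pCons pconst_simps algebra_simps)
qed (simp add: peval_0)

lemma peval_smult: "peval f (smult c h) = pconst c * peval f h"
  by (induction h) (simp_all add: peval_0 peval_pCons pconst_simps algebra_simps)

lemma peval_mult: "peval f (g * h) = peval f g * peval f h"
proof (induction g)
  case (pCons a g)
  then show ?case
    using peval_add[of f "smult a h" "pCons 0 (g * h)"]
    by (simp add: peval_pCons peval_smult pconst_simps algebra_simps)
qed (simp add: peval_0)

lemma peval_linear: "peval f [:- c, 1:] = f - pconst c"
  by (simp add: peval_pCons peval_0 pconst_simps)

lemma peval_prod_linear: "finite F \<Longrightarrow> peval f (\<Prod>c\<in>F. [:- c, 1:]) = (\<Prod>c\<in>F. f - pconst c)"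
proof (induction F rule: finite_induct)
  case empty
  have "peval f [:1:] = 1" by (simp add: peval_pCons peval_0 pconst_simps)
  then show ?case by (simp add: one_pCons)
next
  case (insert c F)
  then show ?case by (simp only: prod.insert[OF insert(1,2)] peval_mult peval_linear)
qed

lemma peval_sum: "peval f (\<Sum>x\<in>S. h x) = (\<Sum>x\<in>S. peval f (h x))"
  by (induction S rule: infinite_finite_induct) (simp_all add: peval_0 peval_add)

text \<open>Over the complex numbers \<open>h\<close> splits into linear factors, and the prime
  \<open>I\<close> must contain the value of one of them, since it contains no nonzero
  constant.\<close>

lemma algebraic_residue:
  assumes I: "prime_ideal I" and "h \<noteq> 0" "peval f h \<in> I"
  shows "\<exists>c. f - pconst c \<in> I"
  using assms(2,3)
proof (induction "degree h" arbitrary: h rule: less_induct)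
  case less
  show ?case
  proof (cases "degree h = 0")
    case True
    then obtain c where c: "h = [:c:]" "c \<noteq> 0" using less.prems(1) by (auto elim: degree_eq_zeroE)
    then have "pconst c \<in> I" using less.prems(2) by (simp add: peval_pCons peval_0)
    then have "pconst (inverse c * c) \<in> I"
      using is_idealD(3)[OF prime_idealD(1)[OF I]] by (auto simp only: pconst_simps)
    then show ?thesis using c(2) prime_idealD(2)[OF I] by (simp add: pconst_simps)
  next
    case False
    then obtain z where "poly h z = 0"
      using fundamental_theorem_of_algebra[of h] by (auto simp: constant_degree)
    then obtain q where q: "h = [:- z, 1:] * q" by (auto simp: poly_eq_0_iff_dvd)
    have "q \<noteq> 0" using q less.prems(1) by auto
    then have "degree q < degree h" unfolding q by (subst degree_mult_eq) auto
    moreover have "f - pconst z \<in> I \<or> peval f q \<in> I"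
      using less.prems(2) prime_idealD(3)[OF I] unfolding q peval_mult peval_linear by blast
    ultimately show ?thesis using less.hyps[of q] \<open>q \<noteq> 0\<close> by blast
  qed
qed

text \<open>If every \<open>f - c\<close> were invertible up to a power of \<open>e\<close> modulo \<open>I\<close>, infinitely many of these
  inverses would have bounded degree, hence be linearly dependent; clearing denominators makes \<open>f\<close>
  algebraic over the scalars.\<close>

lemma nullstellensatz_residue:
  fixes f :: "'v::finite cpoly"
  assumes I: "maximal_avoiding e I" shows "\<exists>c. f - pconst c \<in> I"
proof (rule ccontr)
  assume neg: "\<nexists>c. f - pconst c \<in> I"
  note pr = maximal_avoiding_prime[OF I]
  note Ii = prime_idealD(1)[OF pr]
  have "\<forall>c. \<exists>k r. e ^ k - r * (f - pconst c) \<in> I" using maximal_avoiding_elem[OF I] neg by metis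
  then obtain k r where kr: "\<And>c. e ^ k c - r c * (f - pconst c) \<in> I" by metis
  \<comment> \<open>The largest exponent of any single variable: bounding it by \<open>D\<close>
    leaves only the finitely many monomials of the box \<open>?K\<close>.\<close>
  define deg where "deg p = Max (insert 0 ((\<lambda>(m, v). Poly_Mapping.lookup m v) ` (Poly_Mapping.keys p \<times> UNIV)))"
    for p :: "'v cpoly"
  have deg: "Poly_Mapping.lookup m v \<le> deg p" if "m \<in> Poly_Mapping.keys p" for m v p
    unfolding deg_def using that by (intro Max_ge) (auto intro!: image_eqI[of _ _ "(m, v)"])
  obtain N D where inf: "infinite {c. (k c, deg (r c)) = (N, D)}"
    using infinite_fibre[of "\<lambda>c. (k c, deg (r c))"] by (metis surj_pair)
  let ?K = "{m :: 'v \<Rightarrow>\<^sub>0 nat. \<forall>v. Poly_Mapping.lookup m v \<le> D}"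
  have "finite {g :: 'v \<Rightarrow> nat. \<forall>v. (v \<in> UNIV \<longrightarrow> g v \<in> {..D}) \<and> (v \<notin> UNIV \<longrightarrow> g v = 0)}"
    by (rule finite_set_of_finite_funs) auto
  then have "finite (Poly_Mapping.lookup ` ?K)" by (rule rev_finite_subset) auto
  then have K: "finite ?K"
    by (rule finite_imageD) (auto intro!: inj_onI poly_mapping_eqI)
  obtain F where F: "finite F" "card F = Suc (card ?K)" "F \<subseteq> {c. (k c, deg (r c)) = (N, D)}"
    using infinite_arbitrarily_large[OF inf, of "Suc (card ?K)"] by (elim exE conjE) (rule that)
  have "card ?K < card F" using F(2) by simp
  then obtain a where a: "\<exists>c\<in>F. a c \<noteq> 0" "\<forall>m\<in>?K. (\<Sum>c\<in>F. a c * Poly_Mapping.lookup (r c) m) = 0"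
    using linear_dependence[OF K F(1), of "\<lambda>c. Poly_Mapping.lookup (r c)"] by blast
  have zero: "(\<Sum>c\<in>F. pconst (a c) * r c) = 0"
  proof (rule poly_mapping_eqI)
    fix m
    have "(\<Sum>c\<in>F. a c * Poly_Mapping.lookup (r c) m) = 0"
    proof (cases "m \<in> ?K")
      case False
      then have "Poly_Mapping.lookup (r c) m = 0" if "c \<in> F" for c
        using deg[of m "r c"] F(3) that by (fastforce simp: in_keys_iff)
      then show ?thesis by simp
    qed (use a(2) in blast)
    then show "Poly_Mapping.lookup (\<Sum>c\<in>F. pconst (a c) * r c) m = Poly_Mapping.lookup 0 m"
      by (simp add: lookup_sum lookup_pconst_mult)
  qed
  \<comment> \<open>\<open>h\<close> is the numerator of the partial fraction sum with poles
    \<open>c\<close> and residues \<open>a c\<close>. At a pole only its own term survives, so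
    \<open>h\<close> is nonzero.\<close>
  define h where "h = (\<Sum>c\<in>F. smult (a c) (\<Prod>x\<in>F-{c}. [:- x, 1:]))"
  let ?\<Phi> = "\<lambda>c. \<Prod>x\<in>F-{c}. f - pconst x"
  have ev: "peval f h = (\<Sum>c\<in>F. pconst (a c) * ?\<Phi> c)"
    using F(1) by (simp add: h_def peval_sum peval_smult peval_prod_linear)
  have "h \<noteq> 0"
  proof -
    obtain c where c: "c \<in> F" "a c \<noteq> 0" using a(1) by blast
    have "poly h c = (\<Sum>x\<in>F. a x * (\<Prod>y\<in>F-{x}. c - y))"
      by (simp add: h_def poly_sum poly_prod)
    also have "\<dots> = (\<Sum>x\<in>{c}. a x * (\<Prod>y\<in>F-{x}. c - y))"
      using F(1) c(1) by (intro sum.mono_neutral_right) auto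
    also have "\<dots> \<noteq> 0" using c F(1) by auto
    finally show ?thesis by auto
  qed
  moreover have "peval f h \<in> I"
  proof -
    have clear: "e ^ N * ?\<Phi> c - r c * (\<Prod>x\<in>F. f - pconst x) \<in> I" if "c \<in> F" for c
    proof -
      have "e ^ N * ?\<Phi> c - r c * (\<Prod>x\<in>F. f - pconst x) = (e ^ k c - r c * (f - pconst c)) * ?\<Phi> c"
        using F(3) that by (subst prod.remove[OF F(1) that]) (auto simp: algebra_simps)
      then show ?thesis using is_idealD(4)[OF Ii kr[of c]] by simp
    qed
    \<comment> \<open>The subtracted term is zero by the linear dependence; it pairs each summand
      with the relation \<open>clear\<close>.\<close>
    have "e ^ N * peval f h = e ^ N * peval f h - (\<Sum>c\<in>F. pconst (a c) * r c) * (\<Prod>x\<in>F. f - pconst x)"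
      by (simp add: zero)
    also have "\<dots> = (\<Sum>c\<in>F. pconst (a c) * (e ^ N * ?\<Phi> c - r c * (\<Prod>x\<in>F. f - pconst x)))"
      unfolding ev sum_distrib_left sum_distrib_right sum_subtractf[symmetric]
      by (intro sum.cong refl) (simp add: algebra_simps)
    also have "\<dots> \<in> I" using clear is_idealD(3)[OF Ii] by (intro is_ideal_sum[OF Ii]) blast
    finally show ?thesis
      using prime_idealD(3)[OF pr] I unfolding maximal_avoiding_def by blast
  qed
  ultimately show False using algebraic_residue[OF pr] neg by blast
qed

lemma affine_poisson_bracket:
  fixes gb :: "'v::{finite,linorder} \<Rightarrow> 'v \<Rightarrow> 'v cpoly"
  assumes "\<And>a b. gb a b = - gb b a" shows "affine_poisson (bracket_from_gens gb) pconst"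
proof -
  interpret pre_poisson "bracket_from_gens gb" using pre_poisson_bracket[OF assms] .
  show ?thesis
    by unfold_locales
       (simp_all add: pconst_simps bracket_pconst hilbert_basis nullstellensatz_residue)
qed

section \<open>The Poisson Weyl algebra\<close>

definition A1_theta :: "'n::{finite,linorder} \<Rightarrow> ('n \<times> bool) cpoly" where
  "A1_theta i = 1 + (\<Sum>k\<le>i. Yv k * Xv k)"

locale A1_algebra =
  fixes d :: "complex \<Rightarrow> complex" and Q :: "'n::{finite,linorder} \<Rightarrow> complex"
    and L :: "'n \<Rightarrow> 'n \<Rightarrow> complex"
  assumes d_L_skew: "d (L i j) = - d (L j i)"
begin

lemma gen_bracket_antisym: "A1_gen_bracket d Q L a b = - A1_gen_bracket d Q L b a"
  by (auto simp: A1_gen_bracket_def Let_def split: if_splits)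

sublocale affine_poisson "A1_bracket d Q L" pconst
  unfolding A1_bracket_def by (rule affine_poisson_bracket) (rule gen_bracket_antisym)

abbreviation "pb \<equiv> A1_bracket d Q L"

text \<open>The coefficient in a log-canonical bracket of two generators. The value 0 at equal
  indices is meant for a generator with itself; the pair x_i, y_i has no such coefficient.\<close>

definition gen_weight :: "'n \<times> bool \<Rightarrow> 'n \<times> bool \<Rightarrow> complex" where
  "gen_weight a b =
    (let w = (\<lambda>(j, s) (i, t). if s then (if t then - (d (Q i) + d (L i j)) else d (Q i) + d (L i j))
           else (if t then d (L i j) else d (L j i)))
     in if fst b < fst a then w a b else if fst a < fst b then - w b a else 0)"

lemma pb_gens:
  assumes "fst a \<noteq> fst b \<or> snd a = snd b"
  shows "pb (pvar a) (pvar b) = pconst (gen_weight a b) * pvar a * pvar b"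
proof -
  obtain j s i t where ab: "a = (j, s)" "b = (i, t)" by fastforce
  consider "i < j" | "j < i" | "i = j" by (rule linorder_cases)
  then show ?thesis
    using assms unfolding ab
    by cases (auto simp: A1_bracket_def bracket_pvar A1_gen_bracket_def gen_weight_def Let_def
        Yv_def Xv_def pconst_simps algebra_simps)
qed

lemma pb_X_Y: "pb (Xv i) (Yv i) = pconst (d (Q i)) * A1_theta i"
  by (simp add: A1_bracket_def bracket_pvar Xv_def Yv_def A1_gen_bracket_def A1_theta_def)

lemma pb_Y_X: "pb (Yv i) (Xv i) = - (pconst (d (Q i)) * A1_theta i)"
  by (simp add: pb_antisym[of "Yv i"] pb_X_Y)

definition theta_weight :: "'n \<times> bool \<Rightarrow> complex" where
  "theta_weight v = (if snd v then d (Q (fst v)) else - d (Q (fst v)))"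

text \<open>This is the weight of the product y_k x_k. For \<open>k\<close> below the index of
  \<open>v\<close> the two contributions cancel, and above it what remains depends on
  \<open>v\<close> alone, which makes the theta_m normal.\<close>

lemma gen_weight_sum:
  assumes "k \<noteq> fst v"
  shows "gen_weight v (k, False) + gen_weight v (k, True) = (if k < fst v then 0 else theta_weight v)"
proof -
  obtain i s where v: "v = (i, s)" by fastforce
  show ?thesis using assms d_L_skew[of i k] unfolding v
    by (cases k i rule: linorder_cases; cases s) (simp_all add: gen_weight_def theta_weight_def)
qed

lemma pb_gen_YX:
  "pb (pvar v) (Yv k * Xv k) = pconst (if k < fst v then 0 else theta_weight v) * pvar v *
     (if k = fst v then A1_theta k else Yv k * Xv k)"
proof (cases "k = fst v")
  case True
  obtain i s where v: "v = (i, s)" by fastforce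
  have self: "pb (pvar w) (pvar w) = 0" for w
    using pb_gens[of w w] by (simp add: gen_weight_def pconst_simps)
  show ?thesis
  proof (cases s)
    case s: True
    have "pb (Xv k) (Yv k * Xv k) = pconst (d (Q k)) * A1_theta k * Xv k"
      using self[of "(k, True)"] by (simp add: pb_mult_right pb_X_Y flip: Xv_def)
    then show ?thesis using True s v by (simp add: theta_weight_def Xv_def mult_ac)
  next
    case s: False
    have "pb (Yv k) (Yv k * Xv k) = - (Yv k * (pconst (d (Q k)) * A1_theta k))"
      using self[of "(k, False)"] by (simp add: pb_mult_right pb_Y_X flip: Yv_def)
    then show ?thesis using True s v by (simp add: theta_weight_def Yv_def pconst_simps mult_ac)
  qed
next
  case False
  have "pb (pvar v) (Yv k * Xv k) =
      pconst (gen_weight v (k, False) + gen_weight v (k, True)) * pvar v * (Yv k * Xv k)"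
    using pb_gens[of v "(k, True)"] pb_gens[of v "(k, False)"] False
    by (simp add: pb_mult_right Yv_def Xv_def pconst_simps algebra_simps)
  then show ?thesis using False by (simp only: gen_weight_sum[OF False] if_False)
qed

text \<open>Let i be the index of \<open>v\<close>. In the sum over k, the terms below i vanish, the
  term at i contributes theta_i, and those above i add the missing y_k x_k, all with one common
  weight; together they give theta_m.\<close>

lemma pb_gen_theta:
  "pb (pvar v) (A1_theta m) = pconst (if m < fst v then 0 else theta_weight v) * pvar v * A1_theta m"
proof -
  let ?i = "fst v"
  let ?t = "\<lambda>k. pconst (if k < ?i then 0 else theta_weight v) * pvar v *
     (if k = ?i then A1_theta k else Yv k * Xv k)"
  have eq: "pb (pvar v) (A1_theta m) = (\<Sum>k\<le>m. ?t k)"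
    unfolding A1_theta_def pb_add_right pb_sum_right using pb_one_left pb_antisym[of _ 1]
    by (simp add: pb_gen_YX[unfolded A1_theta_def])
  show ?thesis
  proof (cases "m < ?i")
    case True
    then show ?thesis unfolding eq by (auto simp: pconst_simps intro!: sum.neutral)
  next
    case False
    let ?w = "pconst (theta_weight v) * pvar v"
    have split: "(\<Sum>k\<le>m. g k) = (\<Sum>k<?i. g k) + g ?i + (\<Sum>k\<in>{?i<..m}. g k)" for g :: "'n \<Rightarrow> ('n \<times> bool) cpoly"
    proof -
      have "{..m} = insert ?i ({..<?i} \<union> {?i<..m})" using False by auto
      moreover have "sum g ({..<?i} \<union> {?i<..m}) = sum g {..<?i} + sum g {?i<..m}"
        by (rule sum.union_disjoint) auto
      ultimately show ?thesis by (simp add: add_ac)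
    qed
    have split_i: "(\<Sum>k\<le>?i. g k) = (\<Sum>k<?i. g k) + g ?i" for g :: "'n \<Rightarrow> ('n \<times> bool) cpoly"
    proof -
      have "{..?i} = insert ?i {..<?i}" by auto
      then show ?thesis by (simp add: add_ac)
    qed
    have "(\<Sum>k\<le>m. ?t k) = ?w * A1_theta ?i + (\<Sum>k\<in>{?i<..m}. ?w * (Yv k * Xv k))"
      unfolding split by (auto simp: pconst_simps intro!: sum.cong sum.neutral)
    also have "\<dots> = ?w * A1_theta m"
      unfolding A1_theta_def split split_i by (simp add: sum_distrib_left algebra_simps)
    finally show ?thesis using False eq by simp
  qed
qed

text \<open>For k at most m, y_k and x_k have opposite weights against theta_m, so y_k x_k commutes
  with it.\<close>

lemma pb_theta_theta: "pb (A1_theta n) (A1_theta m) = 0"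
proof -
  have *: "pb (A1_theta n) (A1_theta m) = 0" if "n \<le> m" for n m
  proof -
    have "pb (Yv k * Xv k) (A1_theta m) = 0" if "k \<le> n" for k
      using \<open>n \<le> m\<close> that pb_gen_theta[of "(k, False)" m] pb_gen_theta[of "(k, True)" m]
      by (simp add: pb_mult_left Yv_def Xv_def theta_weight_def pconst_simps)
    then show ?thesis
      by (subst A1_theta_def) (simp add: pb_add_left pb_one_left pb_sum_left)
  qed
  show ?thesis using *[of n m] *[of m n] pb_antisym[of "A1_theta n" "A1_theta m"]
    by (cases "n \<le> m") auto
qed

lemma A1_rational_imp_locally_closed:
  assumes P: "poisson_prime pb P" and rat: "poisson_rational pb pconst P"
  shows "poisson_locally_closed pb P"
proof -
  have Pi: "poisson_ideal pb P" using P by (auto simp: poisson_prime_def)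
  note I = poisson_idealD(1)[OF Pi]
  define G where "G = {(i, s). if s then Yv i \<in> P else True}"
  define Z where "Z = (range A1_theta \<union> pvar ` G) - P"
  have Z: "finite Z" "\<And>z. z \<in> Z \<Longrightarrow> z \<notin> P" by (auto simp: Z_def)
  have comm: "\<exists>x. pb z w = pconst x * z * w" if zw: "z \<in> Z" "w \<in> Z" for z w
  proof -
    consider m n where "z = A1_theta m" "w = A1_theta n" | v m where "z = pvar v" "w = A1_theta m"
      | v m where "z = A1_theta m" "w = pvar v" | a b where "z = pvar a" "w = pvar b" "a \<in> G" "b \<in> G"
      using zw unfolding Z_def by blast
    then show ?thesis
    proof cases
      case 1 then show ?thesis by (intro exI[of _ 0]) (simp add: pb_theta_theta pconst_simps)
    next
      case 2 then show ?thesis using pb_gen_theta by blast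
    next
      case 3
      then have "pb z w = pconst (- (if m < fst v then 0 else theta_weight v)) * z * w"
        unfolding pb_antisym[of z w] by (simp add: pb_gen_theta pconst_simps mult_ac)
      then show ?thesis by blast
    next
      case 4
      have "fst a \<noteq> fst b \<or> snd a = snd b"
      proof (rule ccontr)
        assume "\<not> ?thesis"
        then obtain i s where "a = (i, s)" "b = (i, \<not> s)" by (cases a; cases b) auto
        then have "Yv i \<in> P" "Yv i = z \<or> Yv i = w" using 4 by (cases s; simp add: G_def Yv_def)+
        then show False using Z(2) zw by blast
      qed
      then show ?thesis using pb_gens 4 by blast
    qed
  qed
  then obtain c where c: "\<And>z w. z \<in> Z \<Longrightarrow> w \<in> Z \<Longrightarrow> pb z w = pconst (c z w) * z * w" by metis
  let ?H = "laurent_hull P Z"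
  have hull: "f \<in> ?H" if "f \<in> range A1_theta \<union> pvar ` G" for f
    using laurent_hull_gen[OF I Z(1), of f] laurent_hull_ideal[OF I, of f Z] that
    by (cases "f \<in> P") (auto simp: Z_def)
  have one: "1 \<in> ?H" using laurent_hull_scalar[OF I, of 1 Z] by (simp add: pconst_simps)
  have Y: "Yv i \<in> ?H" for i by (rule hull) (auto simp: Yv_def G_def)
  have X: "Xv i \<in> ?H" for i
  proof (cases "Yv i \<in> P")
    case True then show ?thesis by (intro hull) (auto simp: Xv_def G_def)
  next
    case False
    \<comment> \<open>This is theta at the predecessor of \<open>i\<close>, found as the maximum of
      the smaller indices; for the least index the sum is empty and the value is 1.\<close>
    have pred: "1 + (\<Sum>k<i. Yv k * Xv k) \<in> ?H"
    proof (cases "{..<i} = {}")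
      case True then show ?thesis using one by simp
    next
      case ne: False
      then have "Max {..<i} < i" using Max_in[of "{..<i}"] by simp
      then have "{..<i} = {..Max {..<i}}" using Max_ge[of "{..<i}"] by (auto intro: le_less_trans)
      then have "1 + (\<Sum>k<i. Yv k * Xv k) = A1_theta (Max {..<i})"
        unfolding A1_theta_def by simp
      then show ?thesis using hull by auto
    qed
    have "{..i} = insert i {..<i}" by auto
    then have "Yv i * Xv i = A1_theta i - (1 + (\<Sum>k<i. Yv k * Xv k))"
      by (simp add: A1_theta_def)
    also have "\<dots> \<in> ?H" by (rule laurent_hull_diff[OF I hull pred]) simp
    finally have "Yv i * Xv i \<in> ?H" .
    moreover have "Yv i \<in> Z" using False by (auto simp: Z_def Yv_def G_def)
    ultimately show ?thesis using laurent_hull_cancel[OF I Z(1)] by blast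
  qed
  have "pvar v \<in> ?H" for v
    using X[of "fst v"] Y[of "fst v"] by (cases v; cases "snd v") (auto simp: Xv_def Yv_def)
  then have "f \<in> ?H" for f
    by (rule cpoly_closure[OF laurent_hull_scalar[OF I] _ laurent_hull_add[OF I] laurent_hull_mult[OF I]])
  then show ?thesis using rational_imp_locally_closed[OF P rat Z c] by blast
qed

end

lemma gen_group_member: "g \<in> S \<Longrightarrow> g \<in> gen_group S"
  unfolding gen_group_def by (auto intro!: exI[of _ "{g}"] exI[of _ "\<lambda>_. 1"])

theorem theorem2p22:
  fixes Q :: "'n::{finite,linorder} \<Rightarrow> complex"
    and L :: "'n \<Rightarrow> 'n \<Rightarrow> complex"
    and r :: nat
    and \<eta> :: "nat \<Rightarrow> complex"
    and \<mu> :: "nat \<Rightarrow> complex"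
    and d :: "complex \<Rightarrow> complex"
    and P :: "('n \<times> bool) cpoly set"
  assumes hQ: "\<forall>i. Q i \<noteq> 0 \<and> Q i \<noteq> 1"
    and hL0: "\<forall>i j. L i j \<noteq> 0"
    and hLdiag: "\<forall>i. L i i = 1"
    and hLinv: "\<forall>i j. L i j = inverse (L j i)"
    and htf: "\<forall>g\<in>gen_group (range Q \<union> {L i j | i j. True}).
                \<forall>k::nat. k > 0 \<and> g ^ k = 1 \<longrightarrow> g = 1"
    and hbasis_in: "\<forall>i<r. \<eta> i \<in> gen_group (range Q \<union> {L i j | i j. True})"
    and hbasis: "\<forall>g\<in>gen_group (range Q \<union> {L i j | i j. True}).
                 \<exists>!s::nat \<Rightarrow> int. (\<forall>i\<ge>r. s i = 0) \<and> g = (\<Prod>i<r. \<eta> i powi s i)"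
    and hmu: "\<forall>c::nat \<Rightarrow> rat. (\<Sum>i<r. of_rat (c i) * \<mu> i) = 0 \<longrightarrow> (\<forall>i<r. c i = 0)"
    and hd: "\<forall>s::nat \<Rightarrow> int. d (\<Prod>i<r. \<eta> i powi s i) = (\<Sum>i<r. of_int (s i) * \<mu> i)"
    and hP: "poisson_prime (A1_bracket d Q L) P"
  shows "(poisson_primitive (A1_bracket d Q L) P \<longleftrightarrow> poisson_rational (A1_bracket d Q L) pconst P)
       \<and> (poisson_rational (A1_bracket d Q L) pconst P \<longleftrightarrow> poisson_locally_closed (A1_bracket d Q L) P)"
proof -
  interpret A1_algebra d Q L
  proof
    fix i j
    have "L j i \<in> gen_group (range Q \<union> {L i j | i j. True})" by (rule gen_group_member) auto
    then obtain s :: "nat \<Rightarrow> int" where s: "L j i = (\<Prod>k<r. \<eta> k powi s k)" using hbasis by blast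
    \<comment> \<open>Inverting an element negates its exponent vector, in which \<open>d\<close> is
      additive.\<close>
    have "L i j = (\<Prod>k<r. \<eta> k powi (- s k))"
      using hLinv[rule_format, of i j] unfolding s by (simp add: power_int_minus flip: prod_inversef)
    then show "d (L i j) = - d (L j i)"
      using hd[rule_format, of "\<lambda>k. - s k"] hd[rule_format, of s] s by (simp add: sum_negf)
  qed
  show ?thesis
    using primitive_imp_rational[OF hP] A1_rational_imp_locally_closed[OF hP]
      locally_closed_imp_primitive[OF hP] by blast
qed

end
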